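(* Let $(k,q)$ be a semiprimitive pair with $q=p^m$, $m$ even, and put $n=\frac{q-1}{k}$. Let $t$ be the least positive integer $j$ such that $k\mid p^j+1$, put $s=\frac{m}{2t}$ and $\sigma=(-1)^{s+1}$. Then the spectra of $\Gamma=\Gamma(k,q)$, $\Gamma^+=\Gamma^+(k,q)$ and $\bar\Gamma=\bar\Gamma(k,q)$ are integral, and $$\mathrm{Spec}(\Gamma)=\{[n]^1,[\lambda_1]^n,[\lambda_2]^{(k-1)n}\},$$ $$\mathrm{Spec}(\bar\Gamma)=\{[(k-1)n]^1,[(k-1)\lambda_2]^n,[-1-\lambda_2]^{(k-1)n}\},$$ where $$\lambda_1=\frac{\sigma(k-1)p^{\frac m2}-1}{k}\qquad\text{and}\qquad\lambda_2=-\frac{\sigma p^{\frac m2}+1}{k}.$$ Furthermore, $\mathrm{Spec}(\Gamma^+)=\mathrm{Spec}(\Gamma)$ if $q$ is even and $\mathrm{Spec}(\Gamma^+)=\{[n]^1,[\pm\lambda_1]^{\frac n2},[\pm\lambda_2]^{\frac{(k-1)n}{2}}\}$ if $q$ is odd.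
   Context: Let $p$ be prime, $q=p^m$ and $k\mid q-1$. Put $R_k=\{x^k:x\in\mathbb{F}_q^*\}$. The graph $\Gamma(k,q)$ has vertex set $\mathbb{F}_q$ with an edge from $u$ to $v$ iff $v-u\in R_k$; $\Gamma^+(k,q)$ has vertex set $\mathbb{F}_q$ with an edge from $u$ to $v$ iff $u+v\in R_k$ (loops allowed); $\bar\Gamma(k,q)$ is the complement of $\Gamma(k,q)$. $(k,q)$ is a semiprimitive pair if either $k=2$ and $q\equiv1\pmod4$, or $k>2$, $k\mid p^{t'}+1$ for some positive integer $t'\mid\frac m2$ (with $m$ even), and $k\ne p^{\frac m2}+1$. $\mathrm{Spec}$ denotes the multiset of eigenvalues of the adjacency matrix, $[\lambda]^{r}$ meaning that $\lambda$ occurs with multiplicity $r$, and $[\pm\lambda]^{r}$ meaning that $\lambda$ and $-\lambda$ are each listed with multiplicity $r$. An integral spectrum is one consisting of integers. *)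

theory Defs
  imports
    Complex_Main
    "HOL-Library.Multiset"
    "HOL-Library.Cardinality"
    "HOL-Computational_Algebra.Computational_Algebra"
    "Graph_Theory.Pair_Digraph"
    "Jordan_Normal_Form.Char_Poly"
begin

definition nonzero_powers :: "nat \<Rightarrow> 'a :: finite_field set" where
  "nonzero_powers k = {x ^ k | x. x \<noteq> 0}"

text \<open>The field \<open>'a\<close> plays the role of the field with \<open>q\<close> elements, so \<open>q\<close> is \<open>CARD('a)\<close>
  and does not occur as an explicit argument of the graphs.\<close>

definition gp_graph :: "nat \<Rightarrow> 'a :: finite_field pair_pre_digraph" where
  "gp_graph k = \<lparr>pverts = UNIV, parcs = {(u, v). v - u \<in> nonzero_powers k}\<rparr>"

definition gp_sum_graph :: "nat \<Rightarrow> 'a :: finite_field pair_pre_digraph" where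
  "gp_sum_graph k = \<lparr>pverts = UNIV, parcs = {(u, v). u + v \<in> nonzero_powers k}\<rparr>"

text \<open>The complement is the loopless one.\<close>

definition complement_graph :: "'a pair_pre_digraph \<Rightarrow> 'a pair_pre_digraph" where
  "complement_graph G = \<lparr>pverts = pverts G,
     parcs = {(u, v). u \<in> pverts G \<and> v \<in> pverts G \<and> u \<noteq> v \<and> (u, v) \<notin> parcs G}\<rparr>"

text \<open>The pair is \<open>(k, p ^ m)\<close>; \<open>p\<close> and \<open>m\<close> are recoverable from \<open>q = p ^ m\<close> for prime \<open>p\<close>.\<close>

definition semiprimitive_pair :: "nat \<Rightarrow> nat \<Rightarrow> nat \<Rightarrow> bool" where
  "semiprimitive_pair k p m \<longleftrightarrow>
     (k = 2 \<and> p ^ m mod 4 = 1) \<or>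
     (k > 2 \<and> even m \<and> (\<exists>t'>0. t' dvd m div 2 \<and> k dvd p ^ t' + 1) \<and> k \<noteq> p ^ (m div 2) + 1)"

text \<open>Rows and columns are indexed by the positions in the list \<open>vs\<close> of vertices; a loop
  contributes a diagonal entry 1.\<close>

definition adjacency_mat :: "'a pair_pre_digraph \<Rightarrow> 'a list \<Rightarrow> complex mat" where
  "adjacency_mat G vs = mat (length vs) (length vs)
     (\<lambda>(i, j). if (vs ! i, vs ! j) \<in> parcs G then 1 else 0)"

text \<open>The eigenvalues with their algebraic multiplicities. By the lemma \<open>graph_spec_eq\<close> below,
  the choice of the enumeration of the vertices is irrelevant.\<close>

definition graph_spec :: "'a pair_pre_digraph \<Rightarrow> complex multiset" where
  "graph_spec G =
     proots (char_poly (adjacency_mat G (SOME vs. distinct vs \<and> set vs = pverts G)))"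

lemma similar_adjacency_mat:
  assumes "distinct vs" "distinct ws" "set vs = set ws"
  shows "similar_mat (adjacency_mat G vs) (adjacency_mat G ws)"
proof -
  define n where "n = length vs"
  have lv: "length vs = n" and lw: "length ws = n"
    using assms distinct_card[of vs] distinct_card[of ws] by (simp_all add: n_def)
  define T :: "'a list \<Rightarrow> 'a list \<Rightarrow> complex mat" where
    "T = (\<lambda>xs ys. mat n n (\<lambda>(i, j). if xs ! i = ys ! j then 1 else 0))"
  have T: "T xs ys \<in> carrier_mat n n" for xs ys by (simp add: T_def)
  have A: "adjacency_mat G xs \<in> carrier_mat n n" if "length xs = n" for xs
    using that by (simp add: adjacency_mat_def)
  have pick: "(\<Sum>l = 0..<n. (if x = ys ! l then 1 else 0) * f (ys ! l)) = (f x :: complex)"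
    if "distinct ys" "length ys = n" "x \<in> set ys" for x f ys
  proof -
    have "(\<Sum>l = 0..<n. (if x = ys ! l then 1 else 0) * f (ys ! l))
        = (\<Sum>y\<in>set ys. (if x = y then 1 else 0) * f y)"
      using that by (intro sum.reindex_bij_betw bij_betw_nth) auto
    also have "\<dots> = (\<Sum>y\<in>set ys. if x = y then f y else 0)"
      by (intro sum.cong) auto
    also have "\<dots> = f x" using that by simp
    finally show ?thesis .
  qed
  have TT: "T xs ys * T ys xs = 1\<^sub>m n"
    if "distinct xs" "distinct ys" "length xs = n" "length ys = n" "set xs = set ys" for xs ys
  proof (rule eq_matI)
    fix i j assume "i < dim_row (1\<^sub>m n :: complex mat)" "j < dim_col (1\<^sub>m n :: complex mat)"
    then have ij: "i < n" "j < n" by auto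
    have "(T xs ys * T ys xs) $$ (i, j)
      = (\<Sum>l = 0..<n. (if xs ! i = ys ! l then 1 else 0) * (\<lambda>y. if y = xs ! j then 1 else 0) (ys ! l))"
      using ij by (simp add: T_def scalar_prod_def)
    also have "\<dots> = (if xs ! i = xs ! j then 1 else 0)"
      using ij that by (subst pick) (auto simp flip: that(5))
    also have "\<dots> = 1\<^sub>m n $$ (i, j)"
      using ij that by (simp add: nth_eq_iff_index_eq)
    finally show "(T xs ys * T ys xs) $$ (i, j) = 1\<^sub>m n $$ (i, j)" .
  qed (simp_all add: T_def)
  have AT: "adjacency_mat G vs * T vs ws = T vs ws * adjacency_mat G ws"
  proof (rule eq_matI)
    fix i j
    assume "i < dim_row (T vs ws * adjacency_mat G ws)" "j < dim_col (T vs ws * adjacency_mat G ws)"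
    then have ij: "i < n" "j < n" using lw by (auto simp: T_def adjacency_mat_def)
    let ?e = "if (vs ! i, ws ! j) \<in> parcs G then 1 else 0 :: complex"
    have vi: "vs ! i \<in> set ws" and wj: "ws ! j \<in> set vs"
      using ij lv lw assms(3) nth_mem by metis+
    have "(adjacency_mat G vs * T vs ws) $$ (i, j)
      = (\<Sum>l = 0..<n. (if ws ! j = vs ! l then 1 else 0)
            * (\<lambda>x. if (vs ! i, x) \<in> parcs G then 1 else 0) (vs ! l))"
      using ij lv by (auto simp: T_def adjacency_mat_def scalar_prod_def intro!: sum.cong)
    also have "\<dots> = ?e" by (subst pick[OF assms(1) lv wj]) simp
    finally have 1: "(adjacency_mat G vs * T vs ws) $$ (i, j) = ?e" .
    have "(T vs ws * adjacency_mat G ws) $$ (i, j)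
      = (\<Sum>l = 0..<n. (if vs ! i = ws ! l then 1 else 0)
            * (\<lambda>x. if (x, ws ! j) \<in> parcs G then 1 else 0) (ws ! l))"
      using ij lw by (auto simp: T_def adjacency_mat_def scalar_prod_def intro!: sum.cong)
    also have "\<dots> = ?e" by (subst pick[OF assms(2) lw vi]) simp
    finally show "(adjacency_mat G vs * T vs ws) $$ (i, j) = (T vs ws * adjacency_mat G ws) $$ (i, j)"
      using 1 by simp
  qed (use lv lw in \<open>simp_all add: T_def adjacency_mat_def\<close>)
  have 1: "T vs ws * T ws vs = 1\<^sub>m n" and 2: "T ws vs * T vs ws = 1\<^sub>m n"
    using TT assms lv lw by auto
  have "T vs ws * adjacency_mat G ws * T ws vs = adjacency_mat G vs * (T vs ws * T ws vs)"
    unfolding AT[symmetric] using A[OF lv] T by (intro assoc_mult_mat)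
  then have "adjacency_mat G vs = T vs ws * adjacency_mat G ws * T ws vs"
    using A[OF lv] 1 by simp
  then show ?thesis
    using 1 2 A[OF lv] A[OF lw] T[of vs ws] T[of ws vs]
    unfolding similar_mat_def similar_mat_wit_def Let_def
    by (intro exI[of _ "T vs ws"] exI[of _ "T ws vs"]) auto
qed

lemma graph_spec_eq:
  assumes "distinct vs" "set vs = pverts G"
  shows "graph_spec G = proots (char_poly (adjacency_mat G vs))"
proof -
  let ?ws = "SOME vs. distinct vs \<and> set vs = pverts G"
  have "distinct ?ws \<and> set ?ws = pverts G"
    by (rule someI[of "\<lambda>vs. distinct vs \<and> set vs = pverts G" vs]) (use assms in simp)
  then have "similar_mat (adjacency_mat G ?ws) (adjacency_mat G vs)"
    using assms by (intro similar_adjacency_mat) auto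
  then show ?thesis
    unfolding graph_spec_def by (simp add: char_poly_similar)
qed

end

theory Submission
  imports Defs "HOL-Number_Theory.Cong"
begin

text \<open>Write \<open>q = p ^ m\<close> and \<open>Q = p ^ t\<close>, so that \<open>k\<close> divides \<open>Q + 1\<close> and \<open>q = Q ^ (2 * s)\<close>, and let
\<open>\<psi>\<close> be the additive character \<open>x \<mapsto> exp (2 \<pi> i Tr x / p)\<close> of the field. The functions
\<open>x \<mapsto> \<psi> (b x)\<close> form an orthogonal eigenbasis for \<open>gp_graph k\<close>, with the Gauss periods
\<open>\<eta> b = (\<Sum>r. \<psi> (b r))\<close>, where \<open>r\<close> ranges over the nonzero \<open>k\<close>-th powers, as eigenvalues. They are
also eigenvectors of the complement. The sum graph maps \<open>\<psi> (b x)\<close> to \<open>\<eta> b \<psi> (- b x)\<close>, so for odd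
\<open>q\<close> the functions \<open>\<psi> (b x) + \<psi> (- b x)\<close> and \<open>\<psi> (b x) - \<psi> (- b x)\<close> are eigenvectors with the
eigenvalues \<open>\<eta> b\<close> and \<open>- \<eta> b\<close>; for even \<open>q\<close> the two graphs coincide. It remains to evaluate
\<open>\<eta> b\<close> for \<open>b \<noteq> 0\<close>.

This is done without Gauss sums of multiplicative characters, through the sums
\<open>S a = (\<Sum>x. \<psi> (a x ^ (Q + 1)))\<close>. Three facts determine \<open>S a\<close> for \<open>a \<noteq> 0\<close>.
  \<^item> \<open>S a\<close> is an integer congruent to \<open>1\<close> modulo \<open>Q + 1\<close> (lemma \<open>sum_add_char_power_int\<close>): every
    nonzero element of the prime field is a \<open>(Q + 1)\<close>-th power, so the nonzero values of the trace
    of \<open>a x ^ (Q + 1)\<close> are all taken equally often.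
  \<^item> The form \<open>x \<mapsto> Tr (a x ^ (Q + 1))\<close> is quadratic, and the square of \<open>S a\<close> is \<open>q\<close> times the
    number of elements of its radical (lemma \<open>hermitian_sum_square\<close>).
  \<^item> The radical is trivial, except for \<open>a\<close> in one coset \<open>w R\<close> of the group \<open>R\<close> of nonzero
    \<open>(Q + 1)\<close>-th powers, where it has \<open>Q ^ 2\<close> elements (lemmas \<open>card_hermitian_radical\<close> and
    \<open>hermitian_radical_nontrivial_iff\<close>). Here \<open>w ^ Q = - w\<close>.

Hence \<open>S a\<close> is \<open>Q ^ (s + 1)\<close> or \<open>Q ^ s\<close> up to a sign, and since \<open>Q\<close> is \<open>- 1\<close> modulo \<open>Q + 1\<close> and
\<open>Q + 1 > 2\<close>, the congruence fixes the sign. Averaging \<open>S (b y ^ k)\<close> over \<open>y \<noteq> 0\<close> turns this into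
the value of \<open>\<eta> b\<close> (lemma \<open>gauss_period_eq\<close>), which depends only on whether \<open>b\<close> lies in the coset
of \<open>w\<close> modulo the nonzero \<open>k\<close>-th powers. This coset has \<open>n\<close> elements, which accounts for the
multiplicities; it is closed under negation because \<open>- 1\<close> is a \<open>k\<close>-th power, so for odd \<open>q\<close> it
consists of \<open>n div 2\<close> pairs \<open>{b, - b}\<close>.

That \<open>k\<close> divides \<open>Q + 1\<close> and \<open>t\<close> divides \<open>m div 2\<close> follows from the minimality of \<open>t\<close>
(lemma \<open>semiprimitive_pair_least_exponent\<close>).\<close>

section \<open>Power residues in a finite field\<close>

lemma finite_field_power_card_minus_1:
  fixes x :: "'a :: finite_field"
  assumes "x \<noteq> 0"
  shows "x ^ (CARD('a) - 1) = 1"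
proof -
  have "x * x ^ (CARD('a) - 1) = x * 1"
    using finite_field_power_card_eq_same[of x] zero_less_card_finite[where 'a = 'a]
    by (simp flip: power_Suc)
  then show ?thesis using assms by simp
qed

lemma card_finite_field_ge_2: "CARD('a :: finite_field) \<ge> 2"
proof -
  have "card {0, 1 :: 'a} \<le> CARD('a)" by (rule card_mono) auto
  then show ?thesis by simp
qed

lemma dvd_card_minus_1_pos:
  assumes "d dvd CARD('a :: finite_field) - 1"
  shows "d > 0"
  using assms card_finite_field_ge_2[where 'a = 'a] by (cases "d = 0") auto

text \<open>The polynomial \<open>x ^ (q - 1) - 1 = (x ^ d - 1) * g x\<close> has \<open>q - 1\<close> distinct roots, and neither
factor can have more roots than its degree, so both bounds are attained. Together with the counting
lemmas below, this replaces the choice of a generator of the multiplicative group.\<close>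

lemma card_power_eq_1:
  assumes "d dvd CARD('a :: finite_field) - 1"
  shows "card {x :: 'a. x ^ d = 1} = d"
proof (rule antisym)
  obtain e where e: "CARD('a) - 1 = d * e" using assms by blast
  have d: "d > 0" using assms by (rule dvd_card_minus_1_pos)
  have e0: "e > 0" using e card_finite_field_ge_2[where 'a = 'a] by (cases "e = 0") auto
  define f :: "'a poly" where "f = monom 1 d - 1"
  define g :: "'a poly" where "g = (\<Sum>i<e. monom 1 d ^ i)"
  have fg: "f * g = monom 1 (CARD('a) - 1) - 1"
    unfolding f_def g_def e power_diff_1_eq[symmetric] by (simp add: monom_power)
  have "coeff (f * g) 0 \<noteq> 0"
    using card_finite_field_ge_2[where 'a = 'a] by (simp add: fg)
  then have nz: "f \<noteq> 0" "g \<noteq> 0" by auto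
  have df: "degree f \<le> d" unfolding f_def by (intro degree_diff_le) (auto simp: degree_monom_eq)
  have dg: "degree g \<le> d * (e - 1)"
    unfolding g_def by (intro degree_sum_le) (auto simp: monom_power degree_monom_eq)
  have rf: "{x. poly f x = 0} = {x. x ^ d = 1}"
    by (auto simp: f_def poly_monom)
  show "card {x :: 'a. x ^ d = 1} \<le> d"
    using card_poly_roots_bound[OF nz(1)] df rf by simp
  have "UNIV - {0} \<subseteq> {x. poly f x = 0} \<union> {x. poly g x = 0}"
  proof
    fix x :: 'a assume "x \<in> UNIV - {0}"
    then have "poly (f * g) x = 0"
      using finite_field_power_card_minus_1[of x] by (simp add: fg poly_monom)
    then show "x \<in> {x. poly f x = 0} \<union> {x. poly g x = 0}" by simp
  qed
  then have "card (UNIV - {0 :: 'a}) \<le> card ({x. poly f x = 0} \<union> {x. poly g x = 0})"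
    by (intro card_mono) auto
  also have "\<dots> \<le> card {x. poly f x = 0} + card {x. poly g x = 0}" by (rule card_Un_le)
  also have "card {x. poly g x = 0} \<le> d * (e - 1)"
    using card_poly_roots_bound[OF nz(2)] dg by simp
  finally have "d * e \<le> card {x :: 'a. x ^ d = 1} + d * (e - 1)"
    by (simp add: rf card_Diff_singleton flip: e)
  moreover have "d * e = d + d * (e - 1)" using e0 by (cases e) auto
  ultimately show "d \<le> card {x :: 'a. x ^ d = 1}" by linarith
qed

lemma card_power_eq_power:
  fixes y :: "'a :: finite_field"
  assumes "d dvd CARD('a) - 1" "y \<noteq> 0"
  shows "card {x. x \<noteq> 0 \<and> x ^ d = y ^ d} = d"
proof -
  have d: "d > 0" using assms(1) by (rule dvd_card_minus_1_pos)
  have "bij_betw ((*) y) {z. z ^ d = 1} {x. x \<noteq> 0 \<and> x ^ d = y ^ d}"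
    by (rule bij_betwI[where g = "\<lambda>x. x / y"])
       (use assms d in \<open>auto simp: power_mult_distrib power_divide power_0_left\<close>)
  from bij_betw_same_card[OF this] show ?thesis by (simp add: card_power_eq_1[OF assms(1)])
qed

lemma nonzero_powers_altdef: "nonzero_powers d = (\<lambda>x. x ^ d) ` (UNIV - {0})"
  by (auto simp: nonzero_powers_def)

text \<open>The map \<open>x \<mapsto> x ^ d\<close> is \<open>d\<close>-to-one onto the nonzero \<open>d\<close>-th powers.\<close>

lemma sum_nonzero_power:
  fixes f :: "'a :: finite_field \<Rightarrow> 'b :: comm_semiring_1"
  assumes "d dvd CARD('a) - 1"
  shows "(\<Sum>x\<in>UNIV - {0}. f (x ^ d)) = of_nat d * (\<Sum>r\<in>nonzero_powers d. f r)"
proof -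
  have "(\<Sum>x\<in>UNIV - {0}. f (x ^ d))
      = (\<Sum>r\<in>nonzero_powers d. \<Sum>x\<in>{x \<in> UNIV - {0}. x ^ d = r}. f (x ^ d))"
    unfolding nonzero_powers_altdef by (rule sum.image_gen) simp
  also have "\<dots> = (\<Sum>r\<in>nonzero_powers d. of_nat d * f r)"
  proof (rule sum.cong)
    fix r :: 'a assume "r \<in> nonzero_powers d"
    then obtain y where y: "y \<noteq> 0" "r = y ^ d" by (auto simp: nonzero_powers_def)
    have "(\<Sum>x\<in>{x \<in> UNIV - {0}. x ^ d = r}. f (x ^ d)) = (\<Sum>x\<in>{x. x \<noteq> 0 \<and> x ^ d = y ^ d}. f r)"
      using y by (intro sum.cong) auto
    then show "(\<Sum>x\<in>{x \<in> UNIV - {0}. x ^ d = r}. f (x ^ d)) = of_nat d * f r"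
      using card_power_eq_power[OF assms y(1)] by simp
  qed simp
  finally show ?thesis by (simp add: sum_distrib_left)
qed

lemma card_nonzero_powers:
  assumes "d dvd CARD('a :: finite_field) - 1"
  shows "card (nonzero_powers d :: 'a set) = (CARD('a) - 1) div d"
proof -
  have "(\<Sum>x\<in>UNIV - {0 :: 'a}. 1 :: nat) = d * card (nonzero_powers d :: 'a set)"
    using sum_nonzero_power[OF assms, of "\<lambda>_. 1 :: nat"] by simp
  then show ?thesis using dvd_card_minus_1_pos[OF assms] by (simp add: card_Diff_singleton)
qed

lemma nonzero_powers_iff:
  fixes x :: "'a :: finite_field"
  assumes "d dvd CARD('a) - 1"
  shows "x \<in> nonzero_powers d \<longleftrightarrow> x ^ ((CARD('a) - 1) div d) = 1"
proof -
  have "nonzero_powers d \<subseteq> {x :: 'a. x ^ ((CARD('a) - 1) div d) = 1}"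
    using assms finite_field_power_card_minus_1[where 'a = 'a]
    by (auto simp: nonzero_powers_def simp flip: power_mult)
  moreover have "(CARD('a) - 1) div d dvd CARD('a) - 1"
    using assms by (metis dvd_div_mult_self dvd_triv_left)
  then have "card (nonzero_powers d :: 'a set) = card {x :: 'a. x ^ ((CARD('a) - 1) div d) = 1}"
    using card_nonzero_powers[OF assms] card_power_eq_1 by metis
  ultimately have "nonzero_powers d = {x :: 'a. x ^ ((CARD('a) - 1) div d) = 1}"
    by (intro card_subset_eq) auto
  then show ?thesis by blast
qed

text \<open>For \<open>d * e\<close> dividing \<open>q - 1\<close>, every \<open>e\<close>-th root of unity is a \<open>d\<close>-th power.\<close>

lemma nonzero_powersI:
  fixes x :: "'a :: finite_field"
  assumes "d * e dvd CARD('a) - 1" "x ^ e = 1"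
  shows "x \<in> nonzero_powers d"
proof -
  have d: "d dvd CARD('a) - 1" using assms(1) dvd_mult_left by blast
  have "e dvd (CARD('a) - 1) div d"
    using assms(1) dvd_card_minus_1_pos[OF d] by (auto simp: dvd_def mult.assoc)
  then show ?thesis using assms(2) d by (auto simp: nonzero_powers_iff power_mult)
qed

lemma zero_notin_nonzero_powers [simp]: "0 \<notin> nonzero_powers d"
  by (auto simp: nonzero_powers_def)

section \<open>The absolute trace and the canonical additive character\<close>

lemma of_nat_power_CHAR:
  assumes "prime CHAR('a :: comm_ring_1)"
  shows "(of_nat c :: 'a) ^ CHAR('a) = of_nat c"
  using prime_gt_0_nat[OF assms]
  by (induction c) (simp_all add: freshmans_dream[OF assms refl] power_0_left)

text \<open>The polynomial \<open>y ^ p - y\<close> has at most \<open>p\<close> roots, and the \<open>p\<close> elements of the prime field are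
already roots, so the fixed points of the Frobenius map lie in the prime field.\<close>

lemma power_CHAR_fixed_imp_of_nat:
  fixes y :: "'a :: finite_field"
  assumes "y ^ CHAR('a) = y"
  obtains c where "c < CHAR('a)" "y = of_nat c"
proof -
  define f :: "'a poly" where "f = monom 1 CHAR('a) - monom 1 1"
  have p: "CHAR('a) > 1" using CHAR_prime[where 'a = 'a] prime_gt_1_nat by blast
  have "coeff f CHAR('a) = 1" using p by (simp add: f_def)
  then have "f \<noteq> 0" by auto
  then have "card {x. poly f x = 0} \<le> degree f" by (rule card_poly_roots_bound)
  also have "degree f \<le> CHAR('a)"
    unfolding f_def using p by (intro degree_diff_le) (auto simp: degree_monom_eq)
  finally have "card {x. poly f x = 0} \<le> CHAR('a)" .
  moreover have "inj_on (of_nat :: nat \<Rightarrow> 'a) {..<CHAR('a)}"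
    by (auto simp: inj_on_def of_nat_eq_iff_cong_CHAR cong_def)
  then have "card ((of_nat :: nat \<Rightarrow> 'a) ` {..<CHAR('a)}) = CHAR('a)"
    by (simp add: card_image)
  moreover have "of_nat ` {..<CHAR('a)} \<subseteq> {x. poly f x = 0}"
    by (auto simp: f_def poly_monom of_nat_power_CHAR)
  ultimately have "of_nat ` {..<CHAR('a)} = {x. poly f x = 0}"
    by (intro card_seteq) auto
  moreover have "y \<in> {x. poly f x = 0}" using assms by (simp add: f_def poly_monom)
  ultimately show ?thesis using that by blast
qed

text \<open>A finite field of degree \<open>m\<close> over its prime field. The type argument serves to fix the field.\<close>

locale finite_field_degree =
  fixes m :: nat and F :: "'a :: finite_field itself"
  assumes card_eq: "CARD('a) = CHAR('a) ^ m"
begin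

lemma m_pos: "m > 0"
  using card_eq card_finite_field_ge_2[where 'a = 'a] by (cases m) auto

text \<open>The absolute trace, that is, the trace to the prime field, which is kept as a subset of the field
itself.\<close>

definition abs_trace :: "'a \<Rightarrow> 'a" where
  "abs_trace x = (\<Sum>i<m. x ^ (CHAR('a) ^ i))"

lemma abs_trace_add: "abs_trace (x + y) = abs_trace x + abs_trace y"
  by (simp add: abs_trace_def freshmans_dream' sum.distrib)

lemma abs_trace_of_nat_mult: "abs_trace (of_nat c * x) = of_nat c * abs_trace x"
proof -
  have "of_nat c ^ CHAR('a) ^ i = (of_nat c :: 'a)" for i
    by (induction i) (simp_all add: power_mult of_nat_power_CHAR)
  then show ?thesis by (simp add: abs_trace_def power_mult_distrib sum_distrib_left)
qed

lemma abs_trace_power_CHAR: "abs_trace (x ^ CHAR('a)) = abs_trace x"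
proof -
  have "abs_trace (x ^ CHAR('a)) + x = x + (\<Sum>i<m. x ^ (CHAR('a) ^ Suc i))"
    by (simp add: abs_trace_def power_mult add.commute)
  also have "\<dots> = (\<Sum>i<Suc m. x ^ (CHAR('a) ^ i))"
    by (subst sum.lessThan_Suc_shift) simp
  also have "\<dots> = abs_trace x + x"
    using finite_field_power_card_eq_same[of x] by (simp add: abs_trace_def card_eq)
  finally show ?thesis by simp
qed

lemma abs_trace_power_CHAR_power: "abs_trace (x ^ (CHAR('a) ^ j)) = abs_trace x"
  by (induction j arbitrary: x) (simp_all add: power_mult abs_trace_power_CHAR)

lemma abs_trace_in_prime_field: "\<exists>c. abs_trace x = of_nat c"
proof -
  have "abs_trace x ^ CHAR('a) = abs_trace (x ^ CHAR('a))"
    unfolding abs_trace_def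
    by (subst freshmans_dream_sum) (simp_all add: mult.commute flip: power_mult)
  then show ?thesis
    using power_CHAR_fixed_imp_of_nat[of "abs_trace x"] abs_trace_power_CHAR by metis
qed

lemma abs_trace_nontrivial: "\<exists>x. abs_trace x = 1"
proof -
  have p: "CHAR('a) > 1" using CHAR_prime[where 'a = 'a] prime_gt_1_nat by blast
  define f :: "'a poly" where "f = (\<Sum>i<m. monom 1 (CHAR('a) ^ i))"
  \<comment> \<open>The trace polynomial is nonzero of degree below \<open>q\<close>, so the trace does not vanish identically.\<close>
  have "coeff f 1 = (\<Sum>i<m. if i = 0 then 1 else 0)"
    unfolding f_def coeff_sum by (intro sum.cong) (use p in auto)
  also have "\<dots> = 1" using m_pos by simp
  finally have nz: "f \<noteq> 0" by auto
  have "degree f \<le> CHAR('a) ^ (m - 1)"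
    unfolding f_def using p
    by (intro degree_sum_le) (auto simp: degree_monom_eq intro!: power_increasing)
  also have "\<dots> < CARD('a)" using p m_pos by (simp add: card_eq)
  finally have "card {x. poly f x = 0} < CARD('a)"
    using card_poly_roots_bound[OF nz] by linarith
  then have "{x. poly f x = 0} \<noteq> UNIV" by force
  then obtain x where "poly f x \<noteq> 0" by auto
  then have x: "abs_trace x \<noteq> 0" by (simp add: f_def poly_sum poly_monom abs_trace_def)
  obtain c where c: "abs_trace x = of_nat c" using abs_trace_in_prime_field by blast
  have "inverse (abs_trace x) ^ CHAR('a) = inverse (abs_trace x)"
    by (simp add: power_inverse c of_nat_power_CHAR)
  then obtain d where d: "inverse (abs_trace x) = of_nat d"
    using power_CHAR_fixed_imp_of_nat by metis
  have "abs_trace (of_nat d * x) = inverse (abs_trace x) * abs_trace x"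
    by (simp only: abs_trace_of_nat_mult d)
  also have "\<dots> = 1" using x by simp
  finally have "abs_trace (of_nat d * x) = 1" .
  then show ?thesis by blast
qed

text \<open>The canonical additive character \<open>\<psi>\<close>. The trace is lifted from the prime field to a natural
number; the choice of the least lift is immaterial by \<open>add_char_eqI\<close> below.\<close>

definition add_char :: "'a \<Rightarrow> complex" where
  "add_char x = cis (2 * pi * real (LEAST c. abs_trace x = of_nat c) / real CHAR('a))"

lemma cis_CHAR_cong:
  assumes "[c = d] (mod CHAR('a))"
  shows "cis (2 * pi * real c / real CHAR('a)) = cis (2 * pi * real d / real CHAR('a))"
proof -
  have p: "real CHAR('a) \<noteq> 0" by simp
  have *: "cis (2 * pi * real c / real CHAR('a)) = cis (2 * pi * real (c mod CHAR('a)) / real CHAR('a))" for c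
  proof -
    have "real c = real CHAR('a) * real (c div CHAR('a)) + real (c mod CHAR('a))"
      by (simp flip: of_nat_mult of_nat_add)
    then have "2 * pi * real c / real CHAR('a)
        = 2 * pi * real (c div CHAR('a)) + 2 * pi * real (c mod CHAR('a)) / real CHAR('a)"
      using p by (simp add: field_simps)
    then show ?thesis by (simp flip: cis_mult)
  qed
  show ?thesis using *[of c] *[of d] assms by (simp add: cong_def)
qed

lemma add_char_eqI:
  assumes "abs_trace x = of_nat c"
  shows "add_char x = cis (2 * pi * real c / real CHAR('a))"
proof -
  have "abs_trace x = of_nat (LEAST c. abs_trace x = of_nat c)"
    using assms by (rule LeastI)
  then show ?thesis
    unfolding add_char_def using assms
    by (intro cis_CHAR_cong) (simp flip: of_nat_eq_iff_cong_CHAR)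
qed

lemma add_char_trace_0: "abs_trace x = 0 \<Longrightarrow> add_char x = 1"
  using add_char_eqI[of x 0] by simp

lemma add_char_0 [simp]: "add_char 0 = 1"
  using add_char_trace_0[of 0] abs_trace_of_nat_mult[of 0 0] by simp

lemma add_char_add: "add_char (x + y) = add_char x * add_char y"
proof -
  obtain c d where c: "abs_trace x = of_nat c" and d: "abs_trace y = of_nat d"
    using abs_trace_in_prime_field by metis
  then have "abs_trace (x + y) = of_nat (c + d)" by (simp add: abs_trace_add)
  then show ?thesis
    by (simp only: add_char_eqI[OF c] add_char_eqI[OF d] add_char_eqI cis_mult)
       (simp add: field_simps)
qed

lemma add_char_uminus: "add_char (- x) = cnj (add_char x)"
proof -
  have "add_char (- x) * add_char x = 1" by (simp flip: add_char_add)
  moreover have "add_char x * cnj (add_char x) = 1"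
    by (simp add: add_char_def complex_norm_square[symmetric])
  ultimately show ?thesis
    by (metis mult.assoc mult.commute mult_1)
qed

lemma add_char_diff: "add_char (x - y) = add_char x * cnj (add_char y)"
  using add_char_add[of x "- y"] by (simp add: add_char_uminus)

lemma add_char_power_CHAR_power: "add_char (x ^ (CHAR('a) ^ j)) = add_char x"
  unfolding add_char_def abs_trace_power_CHAR_power ..

lemma sum_cis_CHAR: "(\<Sum>c<CHAR('a). cis (2 * pi * real c / real CHAR('a))) = 0"
proof -
  have p: "CHAR('a) > 1" using CHAR_prime[where 'a = 'a] prime_gt_1_nat by blast
  have "(\<Sum>c<CHAR('a). cis (2 * pi * real c / real CHAR('a))) = \<Sum>{z. z ^ CHAR('a) = 1}"
    using p by (intro sum.reindex_bij_betw bij_betw_roots_unity) simp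
  also have "\<dots> = 0" using p by (rule sum_roots_unity)
  finally show ?thesis .
qed

lemma add_char_nontrivial: "\<exists>x. add_char x \<noteq> 1"
proof -
  have p: "CHAR('a) > 1" using CHAR_prime[where 'a = 'a] prime_gt_1_nat by blast
  obtain x where "abs_trace x = 1" using abs_trace_nontrivial by blast
  then have x: "add_char x = cis (2 * pi * real 1 / real CHAR('a))"
    by (intro add_char_eqI) simp
  have "inj_on (\<lambda>c. cis (2 * pi * real c / real CHAR('a))) {..<CHAR('a)}"
    using p by (intro bij_betw_imp_inj_on[OF bij_betw_roots_unity]) simp
  from inj_onD[OF this, of 1 0] p have "add_char x \<noteq> 1" unfolding x by auto
  then show ?thesis by blast
qed

lemma sum_add_char: "(\<Sum>x\<in>UNIV. add_char (b * x)) = (if b = 0 then of_nat CARD('a) else 0)"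
proof (cases "b = 0")
  case False
  obtain z where z: "add_char z \<noteq> 1" using add_char_nontrivial by blast
  have "(\<Sum>x\<in>UNIV. add_char (b * x)) = (\<Sum>x\<in>UNIV. add_char (b * (x + z / b)))"
    by (rule sum.reindex_bij_witness[of _ "\<lambda>x. x + z / b" "\<lambda>x. x - z / b"]) auto
  also have "\<dots> = (\<Sum>x\<in>UNIV. add_char (b * x)) * add_char z"
    using False by (simp add: distrib_left add_char_add sum_distrib_right)
  finally have "(\<Sum>x\<in>UNIV. add_char (b * x)) * (add_char z - 1) = 0"
    by (simp add: algebra_simps)
  then show ?thesis using z False by simp
qed simp

lemma card_power_preimage:
  assumes "d dvd CARD('a) - 1"
  shows "d dvd card {x :: 'a. x \<noteq> 0 \<and> P (x ^ d)}"
proof -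
  have "card {x :: 'a. x \<noteq> 0 \<and> P (x ^ d)} = (\<Sum>x\<in>UNIV - {0 :: 'a}. of_bool (P (x ^ d)))"
    by (simp add: of_bool_def sum.If_cases) (auto intro!: arg_cong[where f = card])
  also have "\<dots> = d * (\<Sum>r\<in>nonzero_powers d. of_bool (P (r :: 'a)))"
    using sum_nonzero_power[OF assms, of "\<lambda>r. of_bool (P r) :: nat"] by simp
  finally show ?thesis by simp
qed

text \<open>Let \<open>N c\<close> be the number of \<open>x\<close> for which \<open>a * x ^ K\<close> has trace \<open>c\<close>. As the nonzero elements of the
prime field are \<open>K\<close>-th powers, substituting \<open>u * x\<close> for \<open>x\<close> with \<open>u ^ K = c\<close> shows \<open>N c = N 1\<close> for
\<open>c \<noteq> 0\<close>, so the sum equals \<open>N 0 - N 1\<close>. The nonzero solutions \<open>x\<close> come in fibres of size \<open>K\<close>, and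
\<open>x = 0\<close> contributes to \<open>N 0\<close> only.\<close>

lemma sum_add_char_power_int:
  assumes "K * (CHAR('a) - 1) dvd CARD('a) - 1"
  obtains N :: int where "(\<Sum>x\<in>UNIV. add_char (a * x ^ K)) = of_int N" "[N = 1] (mod int K)"
proof -
  let ?p = "CHAR('a)"
  have K: "K dvd CARD('a) - 1" using assms dvd_mult_left by blast
  have K0: "K > 0" using dvd_card_minus_1_pos[OF K] .
  have p: "?p > 1" using CHAR_prime[where 'a = 'a] prime_gt_1_nat by blast
  define A where "A c = {x. abs_trace (a * x ^ K) = of_nat c}" for c
  have cA: "card (A c) = card (A 1)" if "c \<in> {1..<?p}" for c
  proof -
    have c0: "(of_nat c :: 'a) \<noteq> 0"
      using that by (auto simp: of_nat_eq_0_iff_char_dvd dest: dvd_imp_le)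
    have "(of_nat c :: 'a) * of_nat c ^ (?p - 1) = of_nat c * 1"
      using p of_nat_power_CHAR[where 'a = 'a, of c] by (simp flip: power_Suc)
    then have "(of_nat c :: 'a) ^ (?p - 1) = 1" using c0 by simp
    then have "(of_nat c :: 'a) \<in> nonzero_powers K" using assms by (rule nonzero_powersI[rotated])
    then obtain u :: 'a where u: "u \<noteq> 0" "of_nat c = u ^ K" by (auto simp: nonzero_powers_def)
    have e: "abs_trace (a * (u * x) ^ K) = of_nat c * abs_trace (a * x ^ K)" for x
      using abs_trace_of_nat_mult[of c "a * x ^ K"] by (simp add: u(2) power_mult_distrib mult_ac)
    have "bij_betw ((*) u) (A 1) (A c)"
    proof (rule bij_betwI[where g = "\<lambda>x. x / u"])
      show "(*) u \<in> A 1 \<rightarrow> A c" by (auto simp: A_def e)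
      show "(\<lambda>x. x / u) \<in> A c \<rightarrow> A 1"
      proof
        fix x assume "x \<in> A c"
        then have "of_nat c * abs_trace (a * (x / u) ^ K) = of_nat c"
          using e[of "x / u"] u by (simp add: A_def)
        then show "x / u \<in> A 1" using c0 by (simp add: A_def)
      qed
    qed (use u in auto)
    from bij_betw_same_card[OF this] show ?thesis by simp
  qed
  have "(\<Sum>x\<in>UNIV. add_char (a * x ^ K)) = (\<Sum>c<?p. \<Sum>x\<in>A c. add_char (a * x ^ K))"
  proof -
    have "(\<Union>c<?p. A c) = UNIV"
    proof (intro equalityI subsetI UNIV_I)
      fix x
      obtain c where c: "abs_trace (a * x ^ K) = of_nat c" using abs_trace_in_prime_field by blast
      then have "x \<in> A (c mod ?p)"
        by (simp add: A_def of_nat_eq_iff_cong_CHAR cong_def)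
      then show "x \<in> (\<Union>c<?p. A c)" using p by auto
    qed
    then show ?thesis
      by (subst sum.UNION_disjoint[symmetric])
         (auto simp: A_def of_nat_eq_iff_cong_CHAR cong_def)
  qed
  also have "\<dots> = (\<Sum>c<?p. of_nat (card (A c)) * cis (2 * pi * real c / real ?p))"
    by (intro sum.cong) (auto simp: A_def add_char_eqI)
  also have "\<dots> = of_nat (card (A 0)) + of_nat (card (A 1)) * (\<Sum>c\<in>{1..<?p}. cis (2 * pi * real c / real ?p))"
  proof -
    have "{..<?p} = insert 0 {1..<?p}" using p by auto
    moreover have "(\<Sum>c\<in>{1..<?p}. of_nat (card (A c)) * cis (2 * pi * real c / real ?p))
        = (\<Sum>c\<in>{1..<?p}. of_nat (card (A 1)) * cis (2 * pi * real c / real ?p))"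
      by (intro sum.cong) (simp_all only: cA)
    ultimately show ?thesis by (simp add: sum_distrib_left)
  qed
  also have "(\<Sum>c\<in>{1..<?p}. cis (2 * pi * real c / real ?p)) = - 1"
  proof -
    have "{..<?p} = insert 0 {1..<?p}" using p by auto
    then show ?thesis using sum_cis_CHAR by (simp add: eq_neg_iff_add_eq_0 add.commute)
  qed
  finally have S: "(\<Sum>x\<in>UNIV. add_char (a * x ^ K)) = of_int (int (card (A 0)) - int (card (A 1)))"
    by simp
  have t0: "abs_trace 0 = 0" using abs_trace_of_nat_mult[of 0 0] by simp
  have "A 0 = insert 0 {x. x \<noteq> 0 \<and> abs_trace (a * x ^ K) = 0}"
    using K0 by (auto simp: A_def power_0_left t0)
  then have "card (A 0) = Suc (card {x. x \<noteq> 0 \<and> abs_trace (a * x ^ K) = 0})" by simp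
  moreover have "A 1 = {x. x \<noteq> 0 \<and> abs_trace (a * x ^ K) = 1}"
    using K0 by (auto simp: A_def power_0_left t0)
  ultimately have "int K dvd int (card (A 0)) - int (card (A 1)) - 1"
    using card_power_preimage[OF K, of "\<lambda>r. abs_trace (a * r) = 0"]
      card_power_preimage[OF K, of "\<lambda>r. abs_trace (a * r) = 1"]
    by simp
  then have "[int (card (A 0)) - int (card (A 1)) = 1] (mod int K)"
    by (simp add: cong_iff_dvd_diff)
  with S show ?thesis using that by blast
qed

end

section \<open>Hermitian exponential sums\<close>

lemma diff_1_dvd_power_diff_1: "x - 1 dvd x ^ n - (1 :: nat)"
proof (cases "x = 0")
  case False
  then have "[x = 1] (mod (x - 1))" using le_mod_geq[of "x - 1" x] by (simp add: cong_def)
  then have "[x ^ n = 1 ^ n] (mod (x - 1))" by (rule cong_pow)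
  then show ?thesis using cong_to_1_nat by simp
qed (cases n; simp)

text \<open>Since \<open>Q\<close> is \<open>- 1\<close> modulo \<open>Q + 1\<close>, the residue \<open>1\<close> singles out one of the two square roots; this
needs \<open>Q + 1 > 2\<close>.\<close>

lemma square_eq_power_sign:
  fixes N Q :: int
  assumes "Q \<ge> 2" "N ^ 2 = (Q ^ r) ^ 2" "[N = 1] (mod Q + 1)"
  shows "N = (- 1) ^ r * Q ^ r"
proof -
  have "[Q = - 1] (mod Q + 1)" by (simp add: cong_iff_dvd_diff)
  then have Qr: "[Q ^ r = (- 1) ^ r] (mod Q + 1)" by (rule cong_pow)
  have no: "\<not> [- 1 = 1] (mod Q + 1)"
  proof
    assume "[- 1 = 1] (mod Q + 1)"
    then have "Q + 1 dvd 2" by (simp add: cong_iff_dvd_diff)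
    then show False using zdvd_imp_le[of "Q + 1" 2] assms(1) by simp
  qed
  have "N = Q ^ r \<or> N = - (Q ^ r)" using assms(2) by (simp add: power2_eq_iff)
  then show ?thesis
  proof
    assume N: "N = Q ^ r"
    then have "[(- 1) ^ r = 1] (mod Q + 1)"
      using Qr assms(3) cong_sym cong_trans by blast
    then have "even r" using no by (cases "even r") auto
    then show ?thesis using N by simp
  next
    assume N: "N = - (Q ^ r)"
    then have "[- ((- 1) ^ r) = 1] (mod Q + 1)"
      using Qr assms(3) by (metis cong_minus_minus_iff cong_sym cong_trans)
    then have "odd r" using no by (cases "even r") auto
    then show ?thesis using N by simp
  qed
qed

lemma nonzero_powers_mult:
  "x \<in> nonzero_powers d \<Longrightarrow> y \<in> nonzero_powers d \<Longrightarrow> x * y \<in> nonzero_powers d"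
  by (auto simp: nonzero_powers_def) (metis mult_eq_0_iff power_mult_distrib)

lemma nonzero_powers_divide:
  "x \<in> nonzero_powers d \<Longrightarrow> y \<in> nonzero_powers d \<Longrightarrow> x / y \<in> nonzero_powers d"
  by (auto simp: nonzero_powers_def) (metis divide_eq_0_iff power_divide)

lemma nonzero_powers_mono:
  assumes "k dvd K"
  shows "nonzero_powers K \<subseteq> (nonzero_powers k :: 'a :: finite_field set)"
proof
  obtain h where K: "K = h * k" using assms by (metis dvdE mult.commute)
  fix x :: 'a assume "x \<in> nonzero_powers K"
  then obtain y where y: "y \<noteq> 0" "x = y ^ K" by (auto simp: nonzero_powers_def)
  then have "x = (y ^ h) ^ k" by (simp add: K power_mult)
  moreover have "y ^ h \<noteq> 0" using y(1) by simp
  ultimately show "x \<in> nonzero_powers k" unfolding nonzero_powers_def by blast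
qed

text \<open>The field has \<open>q = Q ^ (2 * s)\<close> elements, so it contains the field with \<open>Q ^ 2\<close> elements.\<close>

locale even_power_field = finite_field_degree m F
  for m :: nat and F :: "'a :: finite_field itself" +
  fixes t s Q :: nat
  assumes m_eq: "m = 2 * t * s" and Q_eq: "Q = CHAR('a) ^ t"
begin

lemma t_pos: "t > 0" and s_pos: "s > 0"
  using m_pos m_eq by auto

lemma card_eq_Q: "CARD('a) = Q ^ (2 * s)"
  by (simp add: card_eq m_eq Q_eq mult_ac flip: power_mult)

lemma Q_ge_2: "Q \<ge> 2"
proof -
  have "CHAR('a) \<ge> 2" using CHAR_prime[where 'a = 'a] by (rule prime_ge_2_nat)
  also have "CHAR('a) ^ 1 \<le> Q"
    unfolding Q_eq using t_pos \<open>CHAR('a) \<ge> 2\<close> by (intro power_increasing) auto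
  finally show ?thesis by simp
qed

lemma Q_square_dvd: "Q ^ 2 - 1 dvd CARD('a) - 1"
  using diff_1_dvd_power_diff_1[of "Q ^ 2" s] by (simp add: card_eq_Q flip: power_mult)

lemma Q_plus_minus: "(Q + 1) * (Q - 1) = Q ^ 2 - 1"
  by (simp add: algebra_simps power2_eq_square)

lemma Q_plus_minus_dvd: "(Q + 1) * (Q - 1) dvd CARD('a) - 1"
  using Q_square_dvd by (simp only: Q_plus_minus)

lemma Q_plus_CHAR_dvd: "(Q + 1) * (CHAR('a) - 1) dvd CARD('a) - 1"
proof -
  have "CHAR('a) - 1 dvd Q - 1" unfolding Q_eq by (rule diff_1_dvd_power_diff_1)
  then have "(Q + 1) * (CHAR('a) - 1) dvd (Q + 1) * (Q - 1)" by (rule mult_dvd_mono[OF dvd_refl])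
  then show ?thesis using Q_plus_minus_dvd by (rule dvd_trans)
qed

lemma Q_plus_dvd: "Q + 1 dvd CARD('a) - 1"
  using Q_plus_minus_dvd by (rule dvd_mult_left)

lemma add_power_Q: "(x + y :: 'a) ^ Q = x ^ Q + y ^ Q"
  by (simp add: freshmans_dream' Q_eq)

lemma minus_power_CHAR_power: "(- x :: 'a) ^ (CHAR('a) ^ i) = - (x ^ (CHAR('a) ^ i))"
proof -
  have "(- x) ^ (CHAR('a) ^ i) + x ^ (CHAR('a) ^ i) = (- x + x) ^ (CHAR('a) ^ i)"
    by (rule freshmans_dream'[symmetric]) simp_all
  also have "\<dots> = 0" by (simp add: power_0_left)
  finally show ?thesis by (simp add: eq_neg_iff_add_eq_0)
qed

text \<open>The conjugates of \<open>w\<close> under \<open>x \<mapsto> x ^ Q\<close> are alternately \<open>w\<close> and \<open>- w\<close>, and there are \<open>2 * s\<close> of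
them, so they cancel in the trace to the field with \<open>Q\<close> elements. This argument is uniform in the characteristic, including \<open>2\<close>.\<close>

lemma abs_trace_skew:
  assumes "w ^ Q = - w"
  shows "abs_trace w = 0"
proof -
  define f where "f i = w ^ (CHAR('a) ^ i)" for i
  have f: "f (i + t) = - f i" for i
  proof -
    have "f (i + t) = (w ^ Q) ^ (CHAR('a) ^ i)"
      by (simp add: f_def Q_eq power_add mult.commute flip: power_mult)
    then show ?thesis by (simp add: assms minus_power_CHAR_power f_def)
  qed
  have split: "(\<Sum>i<a + b. g i) = (\<Sum>i<a. g i) + (\<Sum>i<b. g (a + i))" for a b and g :: "nat \<Rightarrow> 'a"
    by (induction b) (simp_all add: add.assoc)
  have "(\<Sum>i<2 * t * n. f i) = 0" for n
  proof (induction n)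
    case (Suc n)
    let ?u = "2 * t * n"
    have "?u + (t + i) = (?u + i) + t" for i by simp
    then have "f (?u + (t + i)) = - f (?u + i)" for i by (simp only: f)
    then have "(\<Sum>i<t. f (?u + (t + i))) = - (\<Sum>i<t. f (?u + i))"
      by (simp only: sum_negf)
    moreover have "(\<Sum>i<t + t. f (?u + i)) = (\<Sum>i<t. f (?u + i)) + (\<Sum>i<t. f (?u + (t + i)))"
      by (rule split)
    moreover have "2 * t * Suc n = ?u + (t + t)" by simp
    ultimately show ?case using Suc by (simp only: split[where a = ?u]) simp
  qed simp
  then show ?thesis unfolding abs_trace_def by (simp add: f_def m_eq)
qed

lemma bij_power_Q: "bij (\<lambda>x :: 'a. x ^ Q)"
proof -
  have "m \<ge> t" using m_eq s_pos by (cases s) auto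
  then have "CARD('a) = Q * CHAR('a) ^ (m - t)" by (simp add: card_eq Q_eq flip: power_add)
  then have "(x ^ Q) ^ (CHAR('a) ^ (m - t)) = x" for x :: 'a
    using finite_field_power_card_eq_same[of x] by (simp flip: power_mult)
  then have "inj (\<lambda>x :: 'a. x ^ Q)" by (metis injI)
  then show ?thesis by (simp add: bij_def finite_UNIV_inj_surj)
qed

text \<open>The exponential sum attached to the quadratic form \<open>x \<mapsto> Tr (a * x ^ (Q + 1))\<close>.\<close>

definition hermitian_sum :: "'a \<Rightarrow> complex" where
  "hermitian_sum a = (\<Sum>x\<in>UNIV. add_char (a * x ^ (Q + 1)))"

text \<open>The radical of the bilinear form \<open>(x, y) \<mapsto> Tr (a * x ^ Q * y + a * x * y ^ Q)\<close> which polarises the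
form above: as \<open>Tr (a * x * y ^ Q) = Tr (a ^ Q * x ^ Q * y ^ (Q ^ 2))\<close>, the form equals
\<open>Tr ((a ^ Q * y ^ (Q ^ 2) + a * y) * x ^ Q)\<close>.\<close>

definition hermitian_radical :: "'a \<Rightarrow> 'a set" where
  "hermitian_radical a = {y. a ^ Q * y ^ (Q ^ 2) + a * y = 0}"

lemma radical_skew:
  assumes "y \<in> hermitian_radical a"
  shows "(a * y ^ (Q + 1)) ^ Q = - (a * y ^ (Q + 1))"
proof -
  have e: "a ^ Q * y ^ (Q ^ 2) = - (a * y)"
    using assms by (simp add: hermitian_radical_def eq_neg_iff_add_eq_0)
  have "(a * y ^ (Q + 1)) ^ Q = a ^ Q * y ^ (Q ^ 2) * y ^ Q"
    by (simp add: power_mult_distrib power2_eq_square mult_ac flip: power_mult)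
  also have "\<dots> = - (a * y ^ (Q + 1))" by (simp add: e mult_ac)
  finally show ?thesis .
qed

text \<open>Squaring and substituting \<open>x + y\<close> for one of the two variables leaves, for each \<open>y\<close>, a complete
character sum over \<open>x\<close>, which vanishes unless \<open>y\<close> is in the radical. On the radical the quadratic
form itself vanishes, by \<open>radical_skew\<close> and \<open>abs_trace_skew\<close>.\<close>

lemma hermitian_sum_square:
  "hermitian_sum a ^ 2 = of_nat (CARD('a) * card (hermitian_radical a))"
proof -
  let ?K = "Q + 1"
  obtain N :: int where "hermitian_sum a = of_int N"
    using sum_add_char_power_int[OF Q_plus_CHAR_dvd, of a] unfolding hermitian_sum_def by metis
  \<comment> \<open>The sum is an integer, hence equal to its complex conjugate.\<close>
  then have "hermitian_sum a ^ 2 = hermitian_sum a * cnj (hermitian_sum a)"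
    by (simp add: power2_eq_square)
  also have "\<dots> = (\<Sum>x\<in>UNIV. \<Sum>z\<in>UNIV. add_char (a * z ^ ?K - a * x ^ ?K))"
    unfolding hermitian_sum_def
    by (subst sum.swap) (simp only: cnj_sum sum_product add_char_diff)
  also have "\<dots> = (\<Sum>x\<in>UNIV. \<Sum>y\<in>UNIV. add_char (a * (x + y) ^ ?K - a * x ^ ?K))"
  proof (rule sum.cong[OF refl])
    fix x
    show "(\<Sum>z\<in>UNIV. add_char (a * z ^ ?K - a * x ^ ?K))
        = (\<Sum>y\<in>UNIV. add_char (a * (x + y) ^ ?K - a * x ^ ?K))"
      by (rule sum.reindex_bij_witness[of _ "\<lambda>y. x + y" "\<lambda>z. z - x"]) auto
  qed
  also have "\<dots> = (\<Sum>x\<in>UNIV. \<Sum>y\<in>UNIV.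
      add_char (a * y ^ ?K) * add_char ((a ^ Q * y ^ (Q ^ 2) + a * y) * x ^ Q))"
  proof (intro sum.cong refl)
    fix x y
    have "a * (x + y) ^ ?K - a * x ^ ?K = a * y ^ ?K + (a * y ^ Q * x + a * y * x ^ Q)"
      by (simp add: add_power_Q algebra_simps)
    \<comment> \<open>The character is invariant under the Frobenius map.\<close>
    moreover have "add_char (a * y ^ Q * x) = add_char (a ^ Q * y ^ (Q ^ 2) * x ^ Q)"
      using add_char_power_CHAR_power[of "a * y ^ Q * x" t, folded Q_eq]
      by (simp add: power_mult_distrib power2_eq_square flip: power_mult)
    ultimately show "add_char (a * (x + y) ^ ?K - a * x ^ ?K)
        = add_char (a * y ^ ?K) * add_char ((a ^ Q * y ^ (Q ^ 2) + a * y) * x ^ Q)"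
      by (simp add: add_char_add distrib_right)
  qed
  also have "\<dots> = (\<Sum>y\<in>UNIV. add_char (a * y ^ ?K) *
      (\<Sum>x\<in>UNIV. add_char ((a ^ Q * y ^ (Q ^ 2) + a * y) * x ^ Q)))"
    by (subst sum.swap) (simp only: sum_distrib_left)
  also have "\<dots> = (\<Sum>y\<in>UNIV. if y \<in> hermitian_radical a then of_nat CARD('a) else 0)"
  proof (intro sum.cong refl)
    fix y
    have "(\<Sum>x\<in>UNIV. add_char ((a ^ Q * y ^ (Q ^ 2) + a * y) * x ^ Q))
        = (\<Sum>x\<in>UNIV. add_char ((a ^ Q * y ^ (Q ^ 2) + a * y) * x))"
      using bij_power_Q by (rule sum.reindex_bij_betw)
    also have "\<dots> = (if y \<in> hermitian_radical a then of_nat CARD('a) else 0)"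
      by (simp add: sum_add_char hermitian_radical_def)
    finally show "add_char (a * y ^ ?K) * (\<Sum>x\<in>UNIV. add_char ((a ^ Q * y ^ (Q ^ 2) + a * y) * x ^ Q))
      = (if y \<in> hermitian_radical a then of_nat CARD('a) else 0)"
      using add_char_trace_0[OF abs_trace_skew[OF radical_skew[of y a]]] by auto
  qed
  also have "\<dots> = of_nat (CARD('a) * card (hermitian_radical a))"
    by (simp add: sum.If_cases mult.commute)
  finally show ?thesis .
qed

lemma power_Q2_eq_self_iff:
  fixes z :: 'a
  assumes "z \<noteq> 0"
  shows "z ^ (Q ^ 2) = z \<longleftrightarrow> z ^ (Q ^ 2 - 1) = 1"
proof -
  have "z ^ (Q ^ 2) = z * z ^ (Q ^ 2 - 1)"
    using Q_ge_2 by (simp flip: power_Suc)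
  then show ?thesis using assms by auto
qed

text \<open>A nonzero element \<open>u\<close> of the radical identifies it with \<open>u\<close> times the field of \<open>Q ^ 2\<close> elements.\<close>

lemma card_hermitian_radical:
  assumes "a \<noteq> 0"
  shows "card (hermitian_radical a) = (if \<exists>y\<in>hermitian_radical a. y \<noteq> 0 then Q ^ 2 else 1)"
proof -
  have Q0: "Q ^ 2 > 0" using Q_ge_2 by simp
  have 0: "0 \<in> hermitian_radical a" using Q0 by (simp add: hermitian_radical_def power_0_left)
  show ?thesis
  proof (cases "\<exists>y\<in>hermitian_radical a. y \<noteq> 0")
    case True
    then obtain u where u: "a ^ Q * u ^ (Q ^ 2) = - (a * u)" "u \<noteq> 0"
      by (auto simp: hermitian_radical_def eq_neg_iff_add_eq_0)
    have one: "z \<noteq> 0" if "z ^ (Q ^ 2 - 1) = 1" for z :: 'a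
      using that one_less_power[of Q 2] Q_ge_2 by (auto simp: power_0_left)
    have "bij_betw ((*) u) {z. z ^ (Q ^ 2 - 1) = 1} (hermitian_radical a - {0})"
    proof (rule bij_betwI[where g = "\<lambda>y. y / u"])
      show "(*) u \<in> {z. z ^ (Q ^ 2 - 1) = 1} \<rightarrow> hermitian_radical a - {0}"
      proof
        fix z :: 'a assume "z \<in> {z. z ^ (Q ^ 2 - 1) = 1}"
        then have z: "z \<noteq> 0" "z ^ (Q ^ 2) = z" using one power_Q2_eq_self_iff by auto
        have "a ^ Q * (u * z) ^ (Q ^ 2) + a * (u * z) = (a ^ Q * u ^ (Q ^ 2) + a * u) * z"
          unfolding power_mult_distrib[of u z] z(2) by (simp add: algebra_simps)
        then show "u * z \<in> hermitian_radical a - {0}"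
          using z(1) u by (simp add: hermitian_radical_def)
      qed
      show "(\<lambda>y. y / u) \<in> hermitian_radical a - {0} \<rightarrow> {z. z ^ (Q ^ 2 - 1) = 1}"
      proof
        fix y assume "y \<in> hermitian_radical a - {0}"
        then have y: "a ^ Q * y ^ (Q ^ 2) = - (a * y)" "y \<noteq> 0"
          by (auto simp: hermitian_radical_def eq_neg_iff_add_eq_0)
        have "(a ^ Q * y ^ (Q ^ 2)) / (a ^ Q * u ^ (Q ^ 2)) = y / u"
          unfolding y(1) u(1) using assms by simp
        then have "(y / u) ^ (Q ^ 2) = y / u" using assms by (simp add: power_divide)
        then show "y / u \<in> {z. z ^ (Q ^ 2 - 1) = 1}"
          using y(2) u(2) power_Q2_eq_self_iff[of "y / u"] by simp
      qed
    qed (use u(2) in auto)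
    from bij_betw_same_card[OF this] have "card (hermitian_radical a - {0}) = Q ^ 2 - 1"
      using card_power_eq_1[OF Q_square_dvd] by simp
    moreover have "card (hermitian_radical a) = Suc (card (hermitian_radical a - {0}))"
      using 0 by (intro card.remove) auto
    ultimately show ?thesis using True Q0 by simp
  next
    case False
    then have "hermitian_radical a = {0}" using 0 by auto
    then show ?thesis by simp
  qed
qed

lemma skew_element_exists: "\<exists>w :: 'a. w \<noteq> 0 \<and> w ^ Q = - w"
proof -
  have "(- 1 :: 'a) ^ (Q + 1) = 1"
    using minus_power_CHAR_power[of 1 t, folded Q_eq] by simp
  then have "(- 1 :: 'a) \<in> nonzero_powers (Q - 1)"
    using Q_plus_minus_dvd by (intro nonzero_powersI[of _ "Q + 1"]) (simp_all only: mult.commute)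
  then obtain w :: 'a where w: "w \<noteq> 0" "- 1 = w ^ (Q - 1)" by (auto simp: nonzero_powers_def)
  have "w ^ Q = w * w ^ (Q - 1)" using Q_ge_2 by (simp flip: power_Suc)
  also have "\<dots> = - w" unfolding w(2)[symmetric] by simp
  finally have "w ^ Q = - w" .
  then show ?thesis using w(1) by blast
qed

text \<open>A chosen nonzero solution of \<open>w ^ Q = - w\<close>. In characteristic \<open>2\<close> it is an arbitrary nonzero
element of the field with \<open>Q\<close> elements.\<close>

definition skew_element :: 'a where
  "skew_element = (SOME w. w \<noteq> 0 \<and> w ^ Q = - w)"

lemma skew_element: "skew_element \<noteq> 0" "skew_element ^ Q = - skew_element"
  using someI_ex[OF skew_element_exists] by (simp_all add: skew_element_def)

text \<open>For \<open>y \<noteq> 0\<close> in the radical, \<open>a * y ^ (Q + 1)\<close> is a skew element by \<open>radical_skew\<close>. Two skew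
elements differ by a factor in the field with \<open>Q\<close> elements, and such a factor is a
\<open>(Q + 1)\<close>-th power.\<close>

lemma hermitian_radical_nontrivial_iff:
  assumes "a \<noteq> 0"
  shows "(\<exists>y\<in>hermitian_radical a. y \<noteq> 0) \<longleftrightarrow> a / skew_element \<in> nonzero_powers (Q + 1)"
proof
  assume "\<exists>y\<in>hermitian_radical a. y \<noteq> 0"
  then obtain y where y: "y \<in> hermitian_radical a" "y \<noteq> 0" by blast
  define c where "c = a * y ^ (Q + 1) / skew_element"
  have c0: "c \<noteq> 0" using assms y skew_element by (simp add: c_def)
  have "c ^ Q = c"
    unfolding c_def power_divide radical_skew[OF y(1)] skew_element(2) by simp
  moreover have "c ^ Q = c * c ^ (Q - 1)" using Q_ge_2 by (simp flip: power_Suc)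
  ultimately have "c ^ (Q - 1) = 1" using c0 by simp
  then have "c \<in> nonzero_powers (Q + 1)" using Q_plus_minus_dvd by (rule nonzero_powersI[rotated])
  moreover have "y ^ (Q + 1) \<in> nonzero_powers (Q + 1)" using y(2) by (auto simp: nonzero_powers_def)
  ultimately have "c / y ^ (Q + 1) \<in> nonzero_powers (Q + 1)" by (rule nonzero_powers_divide)
  then show "a / skew_element \<in> nonzero_powers (Q + 1)" using y(2) by (simp add: c_def)
next
  assume "a / skew_element \<in> nonzero_powers (Q + 1)"
  then obtain u where u: "u \<noteq> 0" "a / skew_element = u ^ (Q + 1)" by (auto simp: nonzero_powers_def)
  then have a: "a = skew_element * u ^ (Q + 1)" using skew_element(1) by (simp add: field_simps)
  have "a ^ Q * (1 / u) ^ (Q ^ 2) = - skew_element * u ^ Q"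
    using u(1) by (simp add: a power_mult_distrib skew_element(2) power_divide power_add
        power2_eq_square flip: power_mult)
  moreover have "a * (1 / u) = skew_element * u ^ Q" using u(1) by (simp add: a)
  ultimately have "1 / u \<in> hermitian_radical a" by (simp add: hermitian_radical_def)
  then show "\<exists>y\<in>hermitian_radical a. y \<noteq> 0" using u(1) by (intro bexI[of _ "1 / u"]) auto
qed

lemma hermitian_sum_eq:
  assumes "a \<noteq> 0"
  shows "hermitian_sum a = (if a / skew_element \<in> nonzero_powers (Q + 1)
    then (- 1) ^ (s + 1) * of_nat Q ^ (s + 1) else (- 1) ^ s * of_nat Q ^ s)"
proof -
  obtain N :: int where N: "hermitian_sum a = of_int N" "[N = 1] (mod int (Q + 1))"
    using sum_add_char_power_int[OF Q_plus_CHAR_dvd, of a] unfolding hermitian_sum_def by metis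
  \<comment> \<open>\<open>r\<close> is the exponent with \<open>q * card (hermitian_radical a) = (Q ^ r) ^ 2\<close>.\<close>
  define r where "r = (if a / skew_element \<in> nonzero_powers (Q + 1) then s + 1 else s)"
  have "CARD('a) * card (hermitian_radical a) = (Q ^ r) ^ 2"
    unfolding card_hermitian_radical[OF assms] hermitian_radical_nontrivial_iff[OF assms] card_eq_Q r_def
    by (simp add: power2_eq_square mult_2_right power_add mult_ac)
  then have "(of_int (N ^ 2) :: complex) = of_int (int ((Q ^ r) ^ 2))"
    using hermitian_sum_square[of a] by (simp only: N(1) of_int_power of_int_of_nat_eq)
  then have "N ^ 2 = (int Q ^ r) ^ 2" by (simp only: of_int_eq_iff of_nat_power)
  then have "N = (- 1) ^ r * int Q ^ r"
    using Q_ge_2 N(2) by (intro square_eq_power_sign) (simp_all add: add.commute)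
  then have "hermitian_sum a = (- 1) ^ r * of_nat Q ^ r" by (simp add: N(1))
  then show ?thesis by (simp add: r_def)
qed

section \<open>Gauss periods\<close>

text \<open>The value of a Gauss period; \<open>V\<close> is a square root of \<open>q\<close>. Summing
\<open>hermitian_sum (b * y ^ k)\<close> over \<open>y \<noteq> 0\<close> in two ways gives the result: since \<open>Q + 1 = k * h\<close>, the argument \<open>b * y ^ k * x ^ (Q + 1)\<close> is
\<open>b * (y * x ^ h) ^ k\<close>, so each \<open>x \<noteq> 0\<close> contributes the same sum over \<open>y\<close>; on the other hand
\<open>hermitian_sum_eq\<close> reduces the sum to counting the \<open>y\<close> with \<open>b * y ^ k\<close> in the exceptional
coset.\<close>

lemma gauss_period_eq:
  assumes k: "k dvd Q + 1" and b: "b \<noteq> 0"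
  defines "V \<equiv> (- 1) ^ (s + 1) * of_nat Q ^ s :: complex"
  shows "of_nat k * (\<Sum>r\<in>nonzero_powers k. add_char (b * r))
    = (if b / skew_element \<in> nonzero_powers k then of_nat k * V else 0) - V - 1"
proof -
  let ?K = "Q + 1" and ?X = "UNIV - {0 :: 'a}"
  let ?n = "of_nat (CARD('a) - 1) :: complex"
  let ?\<eta> = "\<Sum>r\<in>nonzero_powers k. add_char (b * r)"
  have kq: "k dvd CARD('a) - 1" using k Q_plus_dvd by (rule dvd_trans)
  obtain h where h: "?K = k * h" using k by blast
  have h0: "h > 0" using h by (cases h) auto
  have n0: "?n \<noteq> 0" using card_finite_field_ge_2[where 'a = 'a] by (simp del: of_nat_diff)
  have cX: "card ?X = CARD('a) - 1" by (simp add: card_Diff_singleton)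
  have S: "hermitian_sum a = - V + of_nat ?K * V * of_bool (a / skew_element \<in> nonzero_powers ?K)"
    if "a \<noteq> 0" for a
    using hermitian_sum_eq[OF that] by (simp add: V_def algebra_simps)
  have "(\<Sum>y\<in>?X. hermitian_sum (b * y ^ k)) = (\<Sum>x\<in>UNIV. \<Sum>y\<in>?X. add_char (b * y ^ k * x ^ ?K))"
    unfolding hermitian_sum_def by (rule sum.swap)
  also have "\<dots> = (\<Sum>y\<in>?X. add_char (b * y ^ k * 0 ^ ?K))
      + (\<Sum>x\<in>?X. \<Sum>y\<in>?X. add_char (b * y ^ k * x ^ ?K))"
    by (rule sum.remove) auto
  also have "(\<Sum>y\<in>?X. add_char (b * y ^ k * 0 ^ ?K)) = ?n"
    by (simp add: card_Diff_singleton)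
  also have "(\<Sum>x\<in>?X. \<Sum>y\<in>?X. add_char (b * y ^ k * x ^ ?K)) = (\<Sum>x\<in>?X. of_nat k * ?\<eta>)"
  proof (intro sum.cong refl)
    fix x :: 'a assume x: "x \<in> ?X"
    have xK: "x ^ ?K = (x ^ h) ^ k" by (simp only: h mult.commute[of k] power_mult)
    have "(\<Sum>y\<in>?X. add_char (b * y ^ k * x ^ ?K)) = (\<Sum>y\<in>?X. add_char (b * y ^ k))"
      unfolding xK
      by (rule sum.reindex_bij_witness[of _ "\<lambda>y. y / x ^ h" "\<lambda>y. y * x ^ h"])
         (use x in \<open>auto simp: power_mult_distrib mult.assoc\<close>)
    also have "\<dots> = of_nat k * ?\<eta>"
      by (rule sum_nonzero_power[OF kq, of "\<lambda>r. add_char (b * r)"])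
    finally show "(\<Sum>y\<in>?X. add_char (b * y ^ k * x ^ ?K)) = of_nat k * ?\<eta>" .
  qed
  finally have 1: "(\<Sum>y\<in>?X. hermitian_sum (b * y ^ k)) = ?n * (1 + of_nat k * ?\<eta>)"
    by (simp add: card_Diff_singleton algebra_simps)
  have "(\<Sum>y\<in>?X. hermitian_sum (b * y ^ k))
      = (\<Sum>y\<in>?X. - V + of_nat ?K * V * of_bool (b * y ^ k / skew_element \<in> nonzero_powers ?K))"
    using b by (intro sum.cong refl S) auto
  also have "\<dots> = - ?n * V + of_nat ?K * V *
      (\<Sum>y\<in>?X. of_bool (b * y ^ k / skew_element \<in> nonzero_powers ?K))"
    using cX by (simp only: sum.distrib sum_constant sum_distrib_left) (simp add: algebra_simps)
  also have "(\<Sum>y\<in>?X. of_bool (b * y ^ k / skew_element \<in> nonzero_powers ?K))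
      = of_nat k * (\<Sum>r\<in>nonzero_powers k. of_bool (b * r / skew_element \<in> nonzero_powers ?K) :: complex)"
    by (rule sum_nonzero_power[OF kq, of "\<lambda>r. of_bool (b * r / skew_element \<in> nonzero_powers ?K)"])
  also have "(\<Sum>r\<in>nonzero_powers k. of_bool (b * r / skew_element \<in> nonzero_powers ?K) :: complex)
      = (if b / skew_element \<in> nonzero_powers k then of_nat (card (nonzero_powers ?K :: 'a set)) else 0)"
  proof -
    define c where "c = b / skew_element"
    have c0: "c \<noteq> 0" using b skew_element by (simp add: c_def)
    have "card {r \<in> nonzero_powers k. c * r \<in> nonzero_powers ?K}
        = (if c \<in> nonzero_powers k then card (nonzero_powers ?K :: 'a set) else 0)"
    proof (cases "c \<in> nonzero_powers k")
      case True
      have "bij_betw ((*) c) {r \<in> nonzero_powers k. c * r \<in> nonzero_powers ?K} (nonzero_powers ?K)"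
        by (rule bij_betwI[where g = "\<lambda>r. r / c"])
           (use c0 True nonzero_powers_mono[OF k, where 'a = 'a] nonzero_powers_divide in auto)
      from bij_betw_same_card[OF this] True show ?thesis by simp
    next
      case False
      have "c * r \<notin> nonzero_powers ?K" if r: "r \<in> nonzero_powers k" for r
      proof
        assume "c * r \<in> nonzero_powers ?K"
        then have "c * r / r \<in> nonzero_powers k"
          using nonzero_powers_mono[OF k] nonzero_powers_divide r by blast
        moreover have "r \<noteq> 0" using r by (auto simp: nonzero_powers_def)
        ultimately show False using False by simp
      qed
      then have "{r \<in> nonzero_powers k. c * r \<in> nonzero_powers ?K} = {}" by blast
      then show ?thesis using False by simp
    qed
    then show ?thesis by (simp add: c_def of_bool_def sum.If_cases Int_def)
  qed
  finally have 2: "(\<Sum>y\<in>?X. hermitian_sum (b * y ^ k)) = - ?n * V + of_nat ?K * V * (of_nat k *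
      (if b / skew_element \<in> nonzero_powers k then of_nat (card (nonzero_powers ?K :: 'a set)) else 0))" .
  have "?K * card (nonzero_powers ?K :: 'a set) = CARD('a) - 1"
    using Q_plus_dvd by (simp only: card_nonzero_powers dvd_mult_div_cancel)
  then have "of_nat ?K * of_nat (card (nonzero_powers ?K :: 'a set)) = ?n"
    by (simp only: flip: of_nat_mult)
  then have "of_nat ?K * V * (of_nat k *
      (if b / skew_element \<in> nonzero_powers k then of_nat (card (nonzero_powers ?K :: 'a set)) else 0))
    = ?n * (if b / skew_element \<in> nonzero_powers k then of_nat k * V else 0)"
    by (simp only: if_distrib[of "\<lambda>x. _ * x"]) (simp add: mult_ac)
  with 1 2 have "?n * (1 + of_nat k * ?\<eta>)
      = ?n * ((if b / skew_element \<in> nonzero_powers k then of_nat k * V else 0) - V)"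
    by (simp only: right_diff_distrib mult_minus_left uminus_add_conv_diff)
  then have "1 + of_nat k * ?\<eta> = (if b / skew_element \<in> nonzero_powers k then of_nat k * V else 0) - V"
    by (rule mult_left_cancel[OF n0, THEN iffD1])
  then show ?thesis by (simp add: algebra_simps)
qed

end

section \<open>Spectra from orthogonal eigenvectors\<close>

text \<open>The family \<open>f\<close> of eigenvectors is indexed by the vertices themselves, as for the characters of the
additive group of a field. The loop at \<open>u\<close>, if present, is counted in the sum over the
out-neighbours of \<open>u\<close>.\<close>

lemma graph_spec_orthogonal_eigenbasis:
  fixes G :: "'a :: finite pair_pre_digraph" and f :: "'a \<Rightarrow> 'a \<Rightarrow> complex"
  assumes verts: "pverts G = UNIV"
    and orth: "\<And>b c. b \<noteq> c \<Longrightarrow> (\<Sum>x\<in>UNIV. f b x * cnj (f c x)) = 0"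
    and nz: "\<And>b. (\<Sum>x\<in>UNIV. f b x * cnj (f b x)) \<noteq> 0"
    and eigen: "\<And>b u. (\<Sum>v | (u, v) \<in> parcs G. f b v) = \<mu> b * f b u"
  shows "graph_spec G = image_mset \<mu> (mset_set UNIV)"
proof -
  obtain vs :: "'a list" where vs: "distinct vs" "set vs = UNIV"
    using finite_distinct_list[of "UNIV :: 'a set"] by auto
  define n where "n = length vs"
  have sum_vs: "(\<Sum>i = 0..<n. g (vs ! i)) = (\<Sum>x\<in>UNIV. g x)" for g :: "'a \<Rightarrow> complex"
    using vs by (intro sum.reindex_bij_betw bij_betw_nth) (auto simp: n_def)
  define N where "N b = (\<Sum>x\<in>UNIV. f b x * cnj (f b x))" for b
  define A where "A = adjacency_mat G vs"
  define P where "P = mat n n (\<lambda>(i, j). f (vs ! j) (vs ! i))"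
  define P' where "P' = mat n n (\<lambda>(i, j). cnj (f (vs ! i) (vs ! j)) / N (vs ! i))"
  define D where "D = mat n n (\<lambda>(i, j). if i = j then \<mu> (vs ! i) else 0)"
  have carr: "A \<in> carrier_mat n n" "P \<in> carrier_mat n n" "P' \<in> carrier_mat n n" "D \<in> carrier_mat n n"
    by (simp_all add: A_def adjacency_mat_def P_def P'_def D_def n_def)
  have P'P: "P' * P = 1\<^sub>m n"
  proof (rule eq_matI)
    fix i j assume "i < dim_row (1\<^sub>m n :: complex mat)" "j < dim_col (1\<^sub>m n :: complex mat)"
    then have ij: "i < n" "j < n" by auto
    have "(P' * P) $$ (i, j)
        = (\<Sum>l = 0..<n. cnj (f (vs ! i) (vs ! l)) / N (vs ! i) * f (vs ! j) (vs ! l))"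
      using ij by (simp add: P'_def P_def scalar_prod_def)
    also have "\<dots> = (\<Sum>x\<in>UNIV. cnj (f (vs ! i) x) / N (vs ! i) * f (vs ! j) x)"
      by (rule sum_vs)
    also have "\<dots> = (\<Sum>x\<in>UNIV. f (vs ! j) x * cnj (f (vs ! i) x)) / N (vs ! i)"
      by (simp add: sum_divide_distrib mult.commute)
    also have "\<dots> = (if i = j then 1 else 0)"
      using nz orth ij vs by (auto simp: N_def n_def nth_eq_iff_index_eq)
    finally show "(P' * P) $$ (i, j) = 1\<^sub>m n $$ (i, j)" using ij by simp
  qed (simp_all add: P'_def P_def)
  then have PP': "P * P' = 1\<^sub>m n" using carr by (metis mat_mult_left_right_inverse)
  have AP: "A * P = P * D"
  proof (rule eq_matI)
    fix i j assume "i < dim_row (P * D)" "j < dim_col (P * D)"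
    then have ij: "i < n" "j < n" by (auto simp: P_def D_def)
    have "(A * P) $$ (i, j)
        = (\<Sum>l = 0..<n. (if (vs ! i, vs ! l) \<in> parcs G then 1 else 0) * f (vs ! j) (vs ! l))"
      using ij by (simp add: A_def adjacency_mat_def P_def scalar_prod_def flip: n_def)
    also have "\<dots> = (\<Sum>x\<in>UNIV. (if (vs ! i, x) \<in> parcs G then 1 else 0) * f (vs ! j) x)"
      by (rule sum_vs)
    also have "\<dots> = (\<Sum>x\<in>UNIV. if (vs ! i, x) \<in> parcs G then f (vs ! j) x else 0)"
      by (intro sum.cong) auto
    also have "\<dots> = \<mu> (vs ! j) * f (vs ! j) (vs ! i)"
      by (simp add: sum.If_cases eigen)
    also have "\<dots> = (\<Sum>l = 0..<n. f (vs ! l) (vs ! i) * (if l = j then \<mu> (vs ! l) else 0))"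
      using ij by (simp add: if_distrib[of "\<lambda>x. _ * x"] cong: if_cong)
    also have "\<dots> = (P * D) $$ (i, j)"
      using ij by (simp add: P_def D_def scalar_prod_def)
    finally show "(A * P) $$ (i, j) = (P * D) $$ (i, j)" .
  qed (use carr in auto)
  have "P * D * P' = A * (P * P')"
    unfolding AP[symmetric] using carr by (intro assoc_mult_mat)
  then have "A = P * D * P'" using PP' carr by simp
  then have "similar_mat A D"
    unfolding similar_mat_def similar_mat_wit_def Let_def
    using carr PP' P'P by (intro exI[of _ P] exI[of _ P']) auto
  then have "char_poly A = char_poly D" by (rule char_poly_similar)
  also have "\<dots> = (\<Prod>a\<leftarrow>diag_mat D. [:- a, 1:])"
    using carr(4) by (rule char_poly_upper_triangular) (auto simp: upper_triangular_def D_def)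
  also have "diag_mat D = map \<mu> vs"
    by (rule nth_equalityI) (simp_all add: diag_mat_def D_def n_def)
  finally have cp: "char_poly A = (\<Prod>b\<leftarrow>vs. [:- \<mu> b, 1:])" by (simp add: comp_def)
  have "graph_spec G = proots (char_poly A)"
    unfolding A_def using vs verts by (intro graph_spec_eq) auto
  also have "\<dots> = image_mset \<mu> (mset vs)"
    unfolding cp
  proof (induction vs)
    case (Cons b vs)
    have "(\<Prod>b\<leftarrow>vs. [:- \<mu> b, 1:]) \<noteq> 0" by (auto simp: prod_list_zero_iff)
    then have "proots ([:- \<mu> b, 1:] * (\<Prod>b\<leftarrow>vs. [:- \<mu> b, 1:]))
        = proots [:- \<mu> b, 1:] + proots (\<Prod>b\<leftarrow>vs. [:- \<mu> b, 1:])"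
      by (intro proots_mult) auto
    then show ?case using Cons by (simp del: mult_pCons_left)
  qed simp
  also have "mset vs = mset_set UNIV" using mset_set_set[OF vs(1)] vs(2) by simp
  finally show ?thesis .
qed

lemma image_mset_mset_set_const:
  assumes "\<And>x. x \<in> A \<Longrightarrow> f x = c"
  shows "image_mset f (mset_set A) = replicate_mset (card A) c"
proof -
  have "image_mset f (mset_set A) = image_mset (\<lambda>_. c) (mset_set A)"
    using assms by (intro image_mset_cong) (metis elem_mset_set infinite_set_mset_mset_set empty_iff)
  then show ?thesis by (simp add: image_mset_const_eq)
qed

lemma mset_set_UNIV_split:
  fixes A :: "'a :: {finite, zero} set"
  assumes "0 \<notin> A"
  shows "mset_set UNIV = {#0#} + mset_set A + mset_set (- insert 0 A)"
proof -
  have "UNIV = insert 0 (A \<union> - insert 0 A)" by auto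
  then have "mset_set UNIV = mset_set (insert 0 (A \<union> - insert 0 A))" by simp
  also have "\<dots> = add_mset 0 (mset_set (A \<union> - insert 0 A))"
    using assms by (intro mset_set.insert) auto
  also have "mset_set (A \<union> - insert 0 A) = mset_set A + mset_set (- insert 0 A)"
    by (intro mset_set_Union) auto
  finally show ?thesis by simp
qed

text \<open>A set containing exactly one element of each pair \<open>{x, - x}\<close> with \<open>x \<noteq> 0\<close>; it is obtained by
comparing \<open>x\<close> and \<open>- x\<close> under an injection into the natural numbers.\<close>

lemma half_system_exists:
  assumes "\<And>x :: 'a :: {finite, group_add}. x \<noteq> 0 \<Longrightarrow> - x \<noteq> x"
  obtains H :: "'a :: {finite, group_add} set" where "\<And>x. x \<noteq> 0 \<Longrightarrow> - x \<in> H \<longleftrightarrow> x \<notin> H"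
proof -
  obtain e :: "'a \<Rightarrow> nat" where e: "inj e"
    using finite_imp_inj_to_nat_seg[of "UNIV :: 'a set"] by auto
  have "- x \<in> {x. e x < e (- x)} \<longleftrightarrow> x \<notin> {x. e x < e (- x)}" if "x \<noteq> 0" for x
    using assms[OF that] inj_eq[OF e, of x "- x"] by auto
  then show ?thesis using that by blast
qed

lemma image_mset_sign_half_system:
  fixes A :: "'a :: {finite, group_add} set" and c :: "'b :: group_add"
  assumes H: "\<And>x. x \<noteq> 0 \<Longrightarrow> - x \<in> H \<longleftrightarrow> x \<notin> H"
    and A: "0 \<notin> A" "\<And>x. x \<in> A \<Longrightarrow> - x \<in> A"
  shows "image_mset (\<lambda>x. if x \<in> H then c else - c) (mset_set A)
    = replicate_mset (card A div 2) c + replicate_mset (card A div 2) (- c)"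
proof -
  have "- x \<in> H \<longleftrightarrow> x \<notin> H" if "x \<in> A" for x
    using that A(1) by (intro H) auto
  then have "bij_betw uminus (A \<inter> H) (A - H)"
    by (intro bij_betwI[where g = uminus]) (use A(2) in auto)
  then have same: "card (A - H) = card (A \<inter> H)" by (simp add: bij_betw_same_card)
  have "card A = card (A \<inter> H) + card (A - H)"
    using card_Un_disjoint[of "A \<inter> H" "A - H"] by (simp add: Int_Diff_disjoint Int_Diff_Un)
  then have half: "card (A \<inter> H) = card A div 2" using same by simp
  have "mset_set A = mset_set (A \<inter> H) + mset_set (A - H)"
    using mset_set_Union[of "A \<inter> H" "A - H"] by (simp add: Int_Diff_disjoint Int_Diff_Un)
  then show ?thesis
    using image_mset_mset_set_const[of "A \<inter> H" "\<lambda>x. if x \<in> H then c else - c" c]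
      image_mset_mset_set_const[of "A - H" "\<lambda>x. if x \<in> H then c else - c" "- c"]
    by (simp add: same half)
qed

section \<open>Eigenvectors of the three graphs\<close>

context even_power_field
begin

text \<open>The Gauss period \<open>\<eta> b\<close>. It is defined for \<open>b = 0\<close> too, where it is the number of nonzero \<open>k\<close>-th
powers.\<close>

definition gauss_period :: "nat \<Rightarrow> 'a \<Rightarrow> complex" where
  "gauss_period k b = (\<Sum>r\<in>nonzero_powers k. add_char (b * r))"

lemma sum_add_char_cnj:
  "(\<Sum>x\<in>UNIV. add_char (b * x) * cnj (add_char (c * x))) = (if b = c then of_nat CARD('a) else 0)"
  using sum_add_char[of "b - c"] by (simp add: left_diff_distrib add_char_diff)

lemma sum_out_neighbours:
  "(\<Sum>v | (u, v) \<in> parcs (gp_graph k). add_char (b * v)) = gauss_period k b * add_char (b * u)"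
proof -
  have "(\<Sum>v | (u, v) \<in> parcs (gp_graph k). add_char (b * v))
      = (\<Sum>r\<in>nonzero_powers k. add_char (b * (u + r)))"
    by (rule sum.reindex_bij_witness[of _ "\<lambda>r. u + r" "\<lambda>v. v - u"]) (auto simp: gp_graph_def)
  then show ?thesis
    by (simp add: gauss_period_def distrib_left add_char_add sum_distrib_left mult.commute)
qed

lemma sum_sum_neighbours:
  "(\<Sum>v | (u, v) \<in> parcs (gp_sum_graph k). add_char (b * v)) = gauss_period k b * add_char (- b * u)"
proof -
  have "(\<Sum>v | (u, v) \<in> parcs (gp_sum_graph k). add_char (b * v))
      = (\<Sum>r\<in>nonzero_powers k. add_char (b * (r - u)))"
    by (rule sum.reindex_bij_witness[of _ "\<lambda>r. r - u" "\<lambda>v. u + v"]) (auto simp: gp_sum_graph_def)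
  then show ?thesis
    by (simp add: gauss_period_def right_diff_distrib add_char_diff sum_distrib_right add_char_uminus)
qed

lemma graph_spec_gp_graph: "graph_spec (gp_graph k :: 'a pair_pre_digraph) = image_mset (gauss_period k) (mset_set UNIV)"
  by (rule graph_spec_orthogonal_eigenbasis[where f = "\<lambda>b x. add_char (b * x)"])
     (simp_all add: gp_graph_def[THEN arg_cong[where f = pverts]] sum_add_char_cnj sum_out_neighbours)

text \<open>The adjacency matrix of the complement is \<open>J - I - A\<close>; the all-ones matrix \<open>J\<close> has eigenvalue \<open>q\<close>
at the trivial character and \<open>0\<close> at all others.\<close>

lemma graph_spec_complement_gp_graph:
  "graph_spec (complement_graph (gp_graph k :: 'a pair_pre_digraph)) = image_mset
    (\<lambda>b. (if b = 0 then of_nat CARD('a) else 0) - 1 - gauss_period k b) (mset_set UNIV)"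
proof (rule graph_spec_orthogonal_eigenbasis[where f = "\<lambda>b x. add_char (b * x)"])
  fix b u :: 'a
  let ?G = "gp_graph k :: 'a pair_pre_digraph"
  have v: "{v. (u, v) \<in> parcs (complement_graph ?G)} = UNIV - insert u {v. (u, v) \<in> parcs ?G}"
    by (auto simp: complement_graph_def gp_graph_def)
  have u: "u \<notin> {v. (u, v) \<in> parcs ?G}" by (simp add: gp_graph_def)
  have "(\<Sum>v | (u, v) \<in> parcs (complement_graph ?G). add_char (b * v))
      = (\<Sum>v\<in>UNIV. add_char (b * v)) - (add_char (b * u) + gauss_period k b * add_char (b * u))"
    unfolding v using u by (subst sum_diff, simp, simp, subst sum.insert) (simp_all add: sum_out_neighbours)
  also have "(\<Sum>v\<in>UNIV. add_char (b * v)) = (if b = 0 then of_nat CARD('a) else 0) * add_char (b * u)"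
    by (simp add: sum_add_char)
  finally show "(\<Sum>v | (u, v) \<in> parcs (complement_graph ?G). add_char (b * v))
      = ((if b = 0 then of_nat CARD('a) else 0) - 1 - gauss_period k b) * add_char (b * u)"
    by (simp only: left_diff_distrib distrib_right mult_1_left diff_diff_eq)
qed (simp_all add: complement_graph_def gp_graph_def sum_add_char_cnj)

lemma gauss_period_0: "gauss_period k 0 = of_nat (card (nonzero_powers k :: 'a set))"
  by (simp add: gauss_period_def)

context
  fixes k :: nat
  assumes k: "k dvd Q + 1"
begin

lemma k_dvd: "k dvd CARD('a) - 1"
  using k Q_plus_dvd by (rule dvd_trans)

lemma uminus_nonzero_powers:
  assumes "x \<in> nonzero_powers k"
  shows "- x \<in> (nonzero_powers k :: 'a set)"
proof -
  have "(- 1 :: 'a) * (- 1) ^ (Q - 1) = - 1"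
    using minus_power_CHAR_power[of 1 t, folded Q_eq] Q_ge_2 by (simp flip: power_Suc)
  then have "(- 1 :: 'a) ^ (Q - 1) = 1" by simp
  then have "(- 1 :: 'a) \<in> nonzero_powers (Q + 1)" using Q_plus_minus_dvd by (rule nonzero_powersI[rotated])
  then have "(- 1 :: 'a) \<in> nonzero_powers k" using nonzero_powers_mono[OF k] by blast
  from nonzero_powers_mult[OF this assms] show ?thesis by simp
qed

lemma gauss_period_uminus: "gauss_period k (- b) = gauss_period k b"
  unfolding gauss_period_def
  by (rule sum.reindex_bij_witness[of _ uminus uminus]) (auto simp: uminus_nonzero_powers)

text \<open>The eigenvectors are \<open>\<psi> (b x) + \<psi> (- b x)\<close> for \<open>b\<close> in the half system \<open>H\<close> and
\<open>\<psi> (b x) - \<psi> (- b x)\<close> for \<open>b\<close> outside. For \<open>b \<noteq> 0\<close> exactly one of \<open>b\<close> and \<open>- b\<close> is in \<open>H\<close>, so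
each of the two combinations occurs once; \<open>b = 0\<close> is put into \<open>H\<close> to give a nonzero vector. A set
\<open>H\<close> as required exists only in odd characteristic.\<close>

lemma graph_spec_gp_sum_graph:
  assumes H: "\<And>x :: 'a. x \<noteq> 0 \<Longrightarrow> - x \<in> H \<longleftrightarrow> x \<notin> H" and "0 \<in> H"
  shows "graph_spec (gp_sum_graph k :: 'a pair_pre_digraph)
    = image_mset (\<lambda>b. if b \<in> H then gauss_period k b else - gauss_period k b) (mset_set UNIV)"
proof -
  define \<epsilon> :: "'a \<Rightarrow> complex" where "\<epsilon> b = (if b \<in> H then 1 else - 1)" for b
  have \<epsilon>: "cnj (\<epsilon> b) = \<epsilon> b" "\<epsilon> b * \<epsilon> b = 1" "\<epsilon> 0 = 1" for b
    using assms(2) by (simp_all add: \<epsilon>_def)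
  have \<epsilon>m: "\<epsilon> (- b) = - \<epsilon> b" if "b \<noteq> 0" for b
    using H[OF that] by (auto simp: \<epsilon>_def)
  have nm: "b \<noteq> - b" if "b \<noteq> 0" for b :: 'a
    using H[OF that] by metis
  define f where "f b x = add_char (b * x) + \<epsilon> b * add_char (- b * x)" for b x
  \<comment> \<open>The off-diagonal term \<open>b = - c\<close> vanishes for \<open>c \<noteq> 0\<close> because \<open>\<epsilon>\<close> is odd there.\<close>
  have ip: "(\<Sum>x\<in>UNIV. f b x * cnj (f c x)) = of_nat CARD('a) *
      ((1 + \<epsilon> b * \<epsilon> c) * of_bool (b = c) + (\<epsilon> b + \<epsilon> c) * of_bool (b = - c))" for b c
  proof -
    let ?i = "\<lambda>b c. \<Sum>x\<in>UNIV. add_char (b * x) * cnj (add_char (c * x))"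
    have "(\<Sum>x\<in>UNIV. f b x * cnj (f c x))
        = ?i b c + \<epsilon> c * ?i b (- c) + \<epsilon> b * ?i (- b) c + \<epsilon> b * \<epsilon> c * ?i (- b) (- c)"
      unfolding sum_distrib_left sum.distrib[symmetric]
      by (intro sum.cong refl) (simp add: f_def \<epsilon>(1) algebra_simps)
    also have "\<dots> = of_nat CARD('a) *
      ((1 + \<epsilon> b * \<epsilon> c) * of_bool (b = c) + (\<epsilon> b + \<epsilon> c) * of_bool (b = - c))"
      unfolding sum_add_char_cnj by (auto simp: algebra_simps minus_equation_iff[of b c])
    finally show ?thesis .
  qed
  have "graph_spec (gp_sum_graph k :: 'a pair_pre_digraph) = image_mset (\<lambda>b. \<epsilon> b * gauss_period k b) (mset_set UNIV)"
  proof (rule graph_spec_orthogonal_eigenbasis[where f = f])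
    show "(\<Sum>x\<in>UNIV. f b x * cnj (f c x)) = 0" if "b \<noteq> c" for b c
      using that \<epsilon>m[of c] unfolding ip by (cases "c = 0") auto
    show "(\<Sum>x\<in>UNIV. f b x * cnj (f b x)) \<noteq> 0" for b
      using nm[of b] unfolding ip by (cases "b = 0") (auto simp: \<epsilon>)
    show "(\<Sum>v | (u, v) \<in> parcs (gp_sum_graph k). f b v) = \<epsilon> b * gauss_period k b * f b u" for b u
    proof -
      have "(\<Sum>v | (u, v) \<in> parcs (gp_sum_graph k). f b v)
          = gauss_period k b * add_char (- b * u) + \<epsilon> b * (gauss_period k (- b) * add_char (- (- b) * u))"
        unfolding f_def sum.distrib sum_distrib_left[symmetric] sum_sum_neighbours ..
      also have "\<dots> = gauss_period k b * ((\<epsilon> b * \<epsilon> b) * add_char (- b * u) + \<epsilon> b * add_char (b * u))"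
        by (simp add: \<epsilon>(2) gauss_period_uminus algebra_simps)
      also have "\<dots> = \<epsilon> b * gauss_period k b * f b u"
        by (simp add: f_def algebra_simps)
      finally show ?thesis .
    qed
  qed (simp add: gp_sum_graph_def)
  also have "(\<lambda>b. \<epsilon> b * gauss_period k b) = (\<lambda>b. if b \<in> H then gauss_period k b else - gauss_period k b)"
    by (auto simp: \<epsilon>_def)
  finally show ?thesis .
qed

section \<open>The three spectra\<close>

text \<open>The coset of \<open>skew_element\<close> modulo the nonzero \<open>k\<close>-th powers, on which the Gauss period takes the
value \<open>l1\<close>. The other nonzero elements give \<open>l2\<close>.\<close>

definition special_class :: "'a set" where
  "special_class = {b. b / skew_element \<in> nonzero_powers k}"

lemma zero_notin_special_class: "0 \<notin> special_class"
  by (simp add: special_class_def)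

lemma card_special_class: "card special_class = (CARD('a) - 1) div k"
proof -
  have "bij_betw ((*) skew_element) (nonzero_powers k) special_class"
    by (rule bij_betwI[where g = "\<lambda>b. b / skew_element"])
       (use skew_element(1) in \<open>auto simp: special_class_def\<close>)
  from bij_betw_same_card[OF this] show ?thesis by (simp add: card_nonzero_powers[OF k_dvd])
qed

lemma card_other_classes: "card (- insert 0 special_class) = (k - 1) * ((CARD('a) - 1) div k)"
proof -
  have "card (- insert 0 special_class) = CARD('a) - Suc ((CARD('a) - 1) div k)"
    using zero_notin_special_class
    by (simp add: Compl_eq_Diff_UNIV card_Diff_subset card_special_class)
  also have "\<dots> = k * ((CARD('a) - 1) div k) - (CARD('a) - 1) div k"
    using k_dvd by simp
  finally show ?thesis by (simp add: diff_mult_distrib)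
qed

lemma uminus_special_class: "b \<in> special_class \<Longrightarrow> - b \<in> special_class"
  using uminus_nonzero_powers[of "b / skew_element"] by (simp add: special_class_def)

lemma uminus_other_classes: "b \<in> - insert 0 special_class \<Longrightarrow> - b \<in> - insert 0 special_class"
  using uminus_special_class[of "- b"] by auto

text \<open>Here \<open>V\<close> is the square root of \<open>q\<close> with the sign \<open>(- 1) ^ (s + 1)\<close>. The form \<open>l1 = V + l2\<close> makes it
plain that both eigenvalues are integers once \<open>k\<close> divides \<open>V + 1\<close>.\<close>

context
  fixes V l1 l2 :: complex
  assumes V: "V = (- 1) ^ (s + 1) * of_nat Q ^ s"
    and l2: "l2 = - ((V + 1) / of_nat k)" and l1: "l1 = V + l2"
begin

lemma k_mult_l2: "of_nat k * l2 = - (V + 1)"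
  using dvd_card_minus_1_pos[OF k_dvd] by (simp add: l2)

lemma gauss_period_values:
  "b \<in> special_class \<Longrightarrow> gauss_period k b = l1"
  "b \<in> - insert 0 special_class \<Longrightarrow> gauss_period k b = l2"
proof -
  have k0: "(of_nat k :: complex) \<noteq> 0" using dvd_card_minus_1_pos[OF k_dvd] by simp
  have period: "of_nat k * gauss_period k b
      = (if b \<in> special_class then of_nat k * V else 0) - V - 1" if "b \<noteq> 0"
    using gauss_period_eq[OF k that] unfolding gauss_period_def special_class_def V by simp
  show "gauss_period k b = l1" if "b \<in> special_class"
  proof -
    have "b \<noteq> 0" using that zero_notin_special_class by auto
    then have "of_nat k * gauss_period k b = of_nat k * l1"
      using that by (simp add: period l1 distrib_left k_mult_l2)
    then show ?thesis by (rule mult_left_cancel[OF k0, THEN iffD1])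
  qed
  show "gauss_period k b = l2" if "b \<in> - insert 0 special_class"
  proof -
    have "of_nat k * gauss_period k b = of_nat k * l2"
      using that by (simp add: period k_mult_l2)
    then show ?thesis by (rule mult_left_cancel[OF k0, THEN iffD1])
  qed
qed

lemma spectrum_gp_graph:
  assumes n: "n = (CARD('a) - 1) div k"
  shows "graph_spec (gp_graph k :: 'a pair_pre_digraph)
    = {#of_nat n#} + replicate_mset n l1 + replicate_mset ((k - 1) * n) l2"
  using image_mset_mset_set_const[of special_class "gauss_period k" l1]
    image_mset_mset_set_const[of "- insert 0 special_class" "gauss_period k" l2]
  by (simp add: graph_spec_gp_graph mset_set_UNIV_split[OF zero_notin_special_class]
      gauss_period_values gauss_period_0 card_nonzero_powers[OF k_dvd] n
      card_special_class card_other_classes)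

lemma spectrum_complement_gp_graph:
  assumes n: "n = (CARD('a) - 1) div k"
  shows "graph_spec (complement_graph (gp_graph k :: 'a pair_pre_digraph))
    = {#of_nat ((k - 1) * n)#} + replicate_mset n ((of_nat k - 1) * l2)
      + replicate_mset ((k - 1) * n) (- 1 - l2)"
proof -
  let ?f = "\<lambda>b :: 'a. (if b = 0 then of_nat CARD('a) else 0) - 1 - gauss_period k b"
  have "n + (k - 1) * n = k * n"
    using dvd_card_minus_1_pos[OF k_dvd] by (cases k) auto
  also have "\<dots> = CARD('a) - 1" using k_dvd by (simp add: n)
  finally have "CARD('a) = 1 + (n + (k - 1) * n)"
    using card_finite_field_ge_2[where 'a = 'a] by simp
  then have "of_nat CARD('a) = (of_nat (1 + (n + (k - 1) * n)) :: complex)" by (rule arg_cong)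
  then have f0: "?f 0 = of_nat ((k - 1) * n)"
    by (simp add: gauss_period_0 card_nonzero_powers[OF k_dvd] n)
  have "- 1 - l1 = (of_nat k - 1) * l2"
    by (simp add: l1 left_diff_distrib k_mult_l2)
  then have "?f b = (of_nat k - 1) * l2" if "b \<in> special_class" for b
    using that zero_notin_special_class by (auto simp: gauss_period_values)
  then have "image_mset ?f (mset_set special_class) = replicate_mset n ((of_nat k - 1) * l2)"
    unfolding n card_special_class[symmetric] by (rule image_mset_mset_set_const)
  moreover have "?f b = - 1 - l2" if "b \<in> - insert 0 special_class" for b
    using that by (simp add: gauss_period_values)
  then have "image_mset ?f (mset_set (- insert 0 special_class)) = replicate_mset ((k - 1) * n) (- 1 - l2)"
    unfolding n card_other_classes[symmetric] by (rule image_mset_mset_set_const)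
  ultimately show ?thesis
    unfolding graph_spec_complement_gp_graph mset_set_UNIV_split[OF zero_notin_special_class]
      image_mset_union by (simp only: f0 image_mset_single)
qed

lemma spectrum_gp_sum_graph:
  assumes n: "n = (CARD('a) - 1) div k" and odd: "odd CARD('a)"
  shows "graph_spec (gp_sum_graph k :: 'a pair_pre_digraph) = {#of_nat n#}
    + replicate_mset (n div 2) l1 + replicate_mset (n div 2) (- l1)
    + replicate_mset ((k - 1) * n div 2) l2 + replicate_mset ((k - 1) * n div 2) (- l2)"
proof -
  have "- x \<noteq> x" if "x \<noteq> 0" for x :: 'a
  proof
    assume "- x = x"
    then have "of_nat 2 * x = 0" by (metis add.right_inverse mult_2 of_nat_numeral)
    then have "CHAR('a) dvd 2" using that by (simp add: of_nat_eq_0_iff_char_dvd del: of_nat_numeral)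
    then have "CHAR('a) = 2" using primes_dvd_imp_eq[OF CHAR_prime two_is_prime_nat] by blast
    then show False using odd m_pos by (simp add: card_eq)
  qed
  then obtain H' :: "'a set" where "\<And>x. x \<noteq> 0 \<Longrightarrow> - x \<in> H' \<longleftrightarrow> x \<notin> H'"
    using half_system_exists by blast
  then have "- x \<in> insert 0 H' \<longleftrightarrow> x \<notin> insert 0 H'" if "x \<noteq> 0" for x
    using that by auto
  then obtain H :: "'a set" where H: "\<And>x. x \<noteq> 0 \<Longrightarrow> - x \<in> H \<longleftrightarrow> x \<notin> H" "0 \<in> H"
    by blast
  let ?f = "\<lambda>b. if b \<in> H then gauss_period k b else - gauss_period k b"
  have "image_mset ?f (mset_set special_class)
      = image_mset (\<lambda>b. if b \<in> H then l1 else - l1) (mset_set special_class)"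
    by (intro image_mset_cong) (simp add: gauss_period_values)
  moreover have "image_mset ?f (mset_set (- insert 0 special_class))
      = image_mset (\<lambda>b. if b \<in> H then l2 else - l2) (mset_set (- insert 0 special_class))"
    by (intro image_mset_cong) (simp add: gauss_period_values)
  moreover have "?f 0 = of_nat n"
    using H(2) by (simp add: gauss_period_0 card_nonzero_powers[OF k_dvd] n)
  moreover have "graph_spec (gp_sum_graph k :: 'a pair_pre_digraph) = image_mset ?f (mset_set UNIV)"
    using H by (rule graph_spec_gp_sum_graph)
  ultimately show ?thesis
    unfolding mset_set_UNIV_split[OF zero_notin_special_class]
    using image_mset_sign_half_system[OF H(1) zero_notin_special_class uminus_special_class, of l1]
      image_mset_sign_half_system[OF H(1) _ uminus_other_classes, of l2]
    by (simp add: card_special_class card_other_classes n add.assoc)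
qed

end

end

end

lemma gp_sum_graph_even:
  assumes "CHAR('a :: finite_field) = 2"
  shows "gp_sum_graph k = (gp_graph k :: 'a pair_pre_digraph)"
proof -
  have "v - u = u + v" for u v :: 'a
    using uminus_CHAR_2[OF assms, of u] by (metis add.commute diff_conv_add_uminus)
  then show ?thesis by (simp only: gp_graph_def gp_sum_graph_def)
qed

section \<open>Semiprimitive pairs\<close>

lemma CHAR_eq_if_CARD_eq:
  assumes "prime p" "CARD('a :: finite_field) = p ^ m"
  shows "CHAR('a) = p"
proof -
  have "(\<Sum>x\<in>UNIV. x) = (\<Sum>x\<in>UNIV. x + 1 :: 'a)"
    by (rule sum.reindex_bij_witness[of _ "\<lambda>x. x + 1" "\<lambda>x. x - 1"]) auto
  then have "of_nat CARD('a) = (0 :: 'a)" by (simp add: sum.distrib)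
  then have "CHAR('a) dvd p ^ m" unfolding of_nat_eq_0_iff_char_dvd assms(2) .
  then have "CHAR('a) dvd p" using prime_dvd_power CHAR_prime by blast
  then show ?thesis using assms(1) by (intro primes_dvd_imp_eq) auto
qed

text \<open>If \<open>p ^ t\<close> is the first positive power of \<open>p\<close> that is \<open>- 1\<close> modulo \<open>k\<close>, then \<open>p ^ u = - 1\<close> forces
\<open>t\<close> to divide \<open>u\<close>: with \<open>r = u mod t\<close>, the power \<open>p ^ r\<close> is \<open>- 1\<close> or \<open>1\<close>, and for \<open>r > 0\<close> either
\<open>r\<close> or \<open>t - r\<close> would be a smaller exponent.\<close>

lemma least_exponent_dvd:
  fixes k p u t :: nat
  assumes "k > 2" "u > 0" "k dvd p ^ u + 1" and t: "t = (LEAST j. 0 < j \<and> k dvd p ^ j + 1)"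
  shows "t > 0" "k dvd p ^ t + 1" "t dvd u"
proof -
  have "0 < t \<and> k dvd p ^ t + 1"
    unfolding t using assms(2,3) by (intro LeastI[of "\<lambda>j. 0 < j \<and> k dvd p ^ j + 1" u]) auto
  then show t0: "t > 0" and "k dvd p ^ t + 1" by auto
  have iff: "k dvd p ^ j + 1 \<longleftrightarrow> [int p ^ j = - 1] (mod int k)" for j
  proof -
    have "k dvd p ^ j + 1 \<longleftrightarrow> int k dvd int (p ^ j + 1)" by (simp only: int_dvd_int_iff)
    then show ?thesis by (simp add: cong_iff_dvd_diff add.commute)
  qed
  have least: "\<not> [int p ^ j = - 1] (mod int k)" if "0 < j" "j < t" for j
    using not_less_Least[of j "\<lambda>j. 0 < j \<and> k dvd p ^ j + 1"] that unfolding t iff by auto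
  have pt: "[int p ^ t = - 1] (mod int k)" using \<open>k dvd p ^ t + 1\<close> iff by blast
  define r where "r = u mod t"
  have r: "r < t" using t0 by (simp add: r_def)
  have "int p ^ u = (int p ^ t) ^ (u div t) * int p ^ r"
    by (simp add: r_def flip: power_mult power_add)
  moreover have "[(int p ^ t) ^ (u div t) * int p ^ r = (- 1) ^ (u div t) * int p ^ r] (mod int k)"
    using cong_pow[OF pt] by (rule cong_scalar_right)
  moreover have "[int p ^ u = - 1] (mod int k)" using assms(3) iff by blast
  ultimately have u: "[(- 1) ^ (u div t) * int p ^ r = - 1] (mod int k)"
    by (metis cong_sym cong_trans)
  have "r = 0"
  proof (rule ccontr)
    assume r0: "r \<noteq> 0"
    show False
    proof (cases "even (u div t)")
      case True
      then show False using u least[of r] r r0 by simp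
    next
      case False
      then have "[int p ^ r = 1] (mod int k)"
        using u cong_minus_minus_iff[of "int p ^ r" 1 "int k"] by simp
      then have "[int p ^ r * int p ^ (t - r) = 1 * int p ^ (t - r)] (mod int k)"
        by (rule cong_scalar_right)
      moreover have "int p ^ r * int p ^ (t - r) = int p ^ t" using r by (simp flip: power_add)
      ultimately have "[int p ^ (t - r) = - 1] (mod int k)"
        using pt by (metis cong_sym cong_trans mult_1)
      then show False using least[of "t - r"] r r0 by simp
    qed
  qed
  then show "t dvd u" by (simp add: r_def mod_eq_0_iff_dvd)
qed

lemma semiprimitive_pair_least_exponent:
  assumes "prime p" "even m" "m > 0" "semiprimitive_pair k p m"
    and t: "t = (LEAST j. 0 < j \<and> k dvd p ^ j + 1)"
  shows "k dvd p ^ t + 1" "m = 2 * t * (m div (2 * t))"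
proof -
  have "t > 0 \<and> k dvd p ^ t + 1 \<and> t dvd m div 2"
    using assms(4) unfolding semiprimitive_pair_def
  proof (elim disjE conjE exE)
    assume k: "k = 2" and "p ^ m mod 4 = 1"
    have "odd (p ^ m)"
    proof
      assume "even (p ^ m)"
      then have "even (p ^ m mod 4)" by (simp add: dvd_mod)
      then show False using \<open>p ^ m mod 4 = 1\<close> by simp
    qed
    then have "odd p" using assms(3) by simp
    then have "k dvd p ^ 1 + 1" using k by simp
    then have "t = 1" unfolding t by (intro Least_equality) auto
    then show ?thesis using \<open>k dvd p ^ 1 + 1\<close> by simp
  next
    fix u assume "k > 2" "0 < u" "u dvd m div 2" "k dvd p ^ u + 1"
    then show ?thesis using least_exponent_dvd[OF _ _ _ t] dvd_trans by blast
  qed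
  then show "k dvd p ^ t + 1" "m = 2 * t * (m div (2 * t))"
    using assms(2) by (auto elim!: evenE dvdE)
qed

section \<open>Spectra for semiprimitive pairs\<close>

theorem theorem5p4:
  fixes p m k n t s :: nat and \<sigma> l1 l2 :: complex
    and \<Gamma> \<Gamma>plus \<Gamma>bar :: "'a :: finite_field pair_pre_digraph"
  assumes "prime p"
    and "CARD('a) = p ^ m"
    and "even m"
    and "k dvd p ^ m - 1"
    and "semiprimitive_pair k p m"
    and n: "n = (p ^ m - 1) div k"
    and t: "t = (LEAST j. 0 < j \<and> k dvd p ^ j + 1)"
    and s: "s = m div (2 * t)"
    and \<sigma>: "\<sigma> = (- 1) ^ (s + 1)"
    and l1: "l1 = (\<sigma> * (of_nat k - 1) * of_nat p ^ (m div 2) - 1) / of_nat k"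
    and l2: "l2 = - ((\<sigma> * of_nat p ^ (m div 2) + 1) / of_nat k)"
    and \<Gamma>: "\<Gamma> = gp_graph k"
    and \<Gamma>plus: "\<Gamma>plus = gp_sum_graph k"
    and \<Gamma>bar: "\<Gamma>bar = complement_graph \<Gamma>"
  shows "set_mset (graph_spec \<Gamma>) \<subseteq> \<int> \<and>
         set_mset (graph_spec \<Gamma>plus) \<subseteq> \<int> \<and>
         set_mset (graph_spec \<Gamma>bar) \<subseteq> \<int> \<and>
         graph_spec \<Gamma> =
           {#of_nat n#} + replicate_mset n l1 + replicate_mset ((k - 1) * n) l2 \<and>
         graph_spec \<Gamma>bar =
           {#of_nat ((k - 1) * n)#} + replicate_mset n ((of_nat k - 1) * l2)
             + replicate_mset ((k - 1) * n) (- 1 - l2) \<and>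
         (even (p ^ m) \<longrightarrow> graph_spec \<Gamma>plus = graph_spec \<Gamma>) \<and>
         (odd (p ^ m) \<longrightarrow> graph_spec \<Gamma>plus =
           {#of_nat n#}
             + replicate_mset (n div 2) l1 + replicate_mset (n div 2) (- l1)
             + replicate_mset ((k - 1) * n div 2) l2 + replicate_mset ((k - 1) * n div 2) (- l2))"
proof -
  define Q where "Q = p ^ t"
  define V where "V = \<sigma> * of_nat p ^ (m div 2)"
  have char: "CHAR('a) = p" using assms(1,2) by (rule CHAR_eq_if_CARD_eq)
  have "m > 0" using assms(2) card_finite_field_ge_2[where 'a = 'a] by (cases m) auto
  then have kQ: "k dvd Q + 1" and m: "m = 2 * t * s"
    using semiprimitive_pair_least_exponent[OF assms(1,3) _ assms(5) t] by (auto simp: Q_def s)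
  interpret even_power_field m "TYPE('a)" t s Q
    by unfold_locales (simp_all add: assms(2) char m Q_def)
  have k0: "k > 0" using k_dvd[OF kQ] by (rule dvd_card_minus_1_pos)
  have V: "V = (- 1) ^ (s + 1) * of_nat Q ^ s"
    by (simp add: V_def \<sigma> Q_def m power_mult)
  have l2': "l2 = - ((V + 1) / of_nat k)" by (simp add: l2 V_def)
  have l1': "l1 = V + l2" using k0 by (simp add: l1 l2 V_def field_simps)
  have n': "n = (CARD('a) - 1) div k" by (simp add: n assms(2))
  note spec = spectrum_gp_graph[OF kQ V l2' l1' n'] spectrum_complement_gp_graph[OF kQ V l2' l1' n']
    spectrum_gp_sum_graph[OF kQ V l2' l1' n']
  have specplus: "graph_spec \<Gamma>plus = graph_spec \<Gamma>" if "even (p ^ m)"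
  proof -
    have "p = 2" using that assms(1) primes_dvd_imp_eq[OF two_is_prime_nat, of p] by auto
    then show ?thesis by (simp add: \<Gamma>plus \<Gamma> gp_sum_graph_even char)
  qed
  \<comment> \<open>Integrality of \<open>l2\<close>: \<open>Q\<close> is \<open>- 1\<close> modulo \<open>k\<close>, so \<open>v\<close> is \<open>(- 1) ^ (2 * s + 1)\<close> modulo \<open>k\<close>.\<close>
  define v where "v = (- 1) ^ (s + 1) * int Q ^ s"
  have "[int Q = - 1] (mod int k)"
    using kQ by (simp add: cong_iff_dvd_diff add.commute flip: int_dvd_int_iff)
  then have "[v = (- 1) ^ (s + 1) * (- 1) ^ s] (mod int k)"
    unfolding v_def by (intro cong_scalar_left cong_pow)
  then have "int k dvd v + 1" by (simp add: cong_iff_dvd_diff flip: power_add)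
  then obtain j where j: "v + 1 = int k * j" by blast
  have vV: "of_int v = V" by (simp add: v_def V)
  have "V + 1 = of_nat k * of_int j"
    using arg_cong[OF j, of "of_int :: int \<Rightarrow> complex"] by (simp add: vV)
  then have "l2 = of_int (- j)" using k0 by (simp add: l2')
  then have l2_int: "l2 \<in> \<int>" by simp
  have "V \<in> \<int>" unfolding vV[symmetric] by simp
  then have l1_int: "l1 \<in> \<int>" using l2_int by (simp add: l1')
  have I: "set_mset (graph_spec \<Gamma>) \<subseteq> \<int>"
    using l1_int l2_int by (auto simp: \<Gamma> spec(1) in_replicate_mset)
  have Ibar: "set_mset (graph_spec \<Gamma>bar) \<subseteq> \<int>"
    using l2_int by (auto simp: \<Gamma>bar \<Gamma> spec(2) in_replicate_mset)
  have Iplus: "set_mset (graph_spec \<Gamma>plus) \<subseteq> \<int>"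
  proof (cases "even (p ^ m)")
    case True
    then show ?thesis using specplus I by simp
  next
    case False
    then have "graph_spec \<Gamma>plus = {#of_nat n#}
      + replicate_mset (n div 2) l1 + replicate_mset (n div 2) (- l1)
      + replicate_mset ((k - 1) * n div 2) l2 + replicate_mset ((k - 1) * n div 2) (- l2)"
      unfolding \<Gamma>plus using False by (intro spec(3)) (simp add: assms(2))
    then show ?thesis using l1_int l2_int by (auto simp: in_replicate_mset)
  qed
  show ?thesis
    using I Ibar Iplus spec specplus unfolding \<Gamma> \<Gamma>plus \<Gamma>bar assms(2) by blast
qed

end
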